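(* Let $m,n\ge 0$ be integers and let $U\cong m\mathbb{1}\oplus nP$ be an object of $\mathrm{Ver}_4^+$. Any non-degenerate symmetric bilinear form $\beta$ on $U$ is equivalent to one of the following forms: (A) $\alpha_1^m+\frac n2\,\beta_{2P}(0)$, where $m>0$ and $2\mid n$; (B) $\alpha_1^m+n\,\beta_P(0)$, where $m>0$ and $n>0$; (C) $\alpha_2^m+\frac n2\,\beta_{2P}(0)$, where $2\mid m$ and $2\mid n$; (D) $\alpha_2^m+\beta_{2P}(1)+\frac{n-2}{2}\,\beta_{2P}(0)$, where $2\mid m$, $2\mid n$ and $n\ge 2$; (E) $\alpha_2^m+n\,\beta_P(y)$, where $y\in\mathbb{K}$, $2\mid m$ and $n>0$; (F) $\alpha_2^m+(n-2)\,\beta_P(0)+\beta_P(1)+\beta_P(y)$, where $y\in\mathbb{K}$, $2\mid m$, $n\ge 2$ and $(1+y,n)\ne(0,2)$.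
   Context: $\mathbb{K}$ is an algebraically closed field of characteristic $2$. $\mathrm{Ver}_4^+$ is the symmetric tensor category whose objects are (finite-dimensional) modules over $A=\mathbb{K}[t]/(t^2)$, whose morphisms are linear maps commuting with $t$, with tensor product action $t.(u\otimes u')=(t.u)\otimes u'+u\otimes(t.u')$, unit object $\mathbb{1}=\mathbb{K}$ (with $t$ acting by $0$), and braiding $c_{U,U'}(u\otimes u')=u'\otimes u+(t.u')\otimes(t.u)$. $P$ is the two-dimensional indecomposable module, with basis $w,x$, $t.w=x$, $t.x=0$. Every object is isomorphic to $m\mathbb{1}\oplus nP$ for unique $m,n\ge0$. A bilinear form on $U$ is a morphism $\beta:U\otimes U\to\mathbb{1}$ (so $\beta(t.u,u')=\beta(u,t.u')$). It is symmetric if $\beta\circ c_{U,U}=\beta$, and non-degenerate if the induced map $U\to U^*$ is an isomorphism. Forms $\beta$ on $U$ and $\gamma$ on $U'$ are equivalent (isomorphic) if there is an isomorphism $\phi:U'\to U$ in $\mathrm{Ver}_4^+$ with $\gamma=\beta\circ(\phi\otimes\phi)$. The sum $\beta+\gamma$ is the orthogonal direct sum form on $U\oplus U'$, and $k\beta$ (for an integer $k\ge0$) is the sum of $k$ copies of $\beta$. Named forms: $\alpha_1^m$ is the form on $m\mathbb{1}$ with identity Gram matrix; $\alpha_2^m$ ($m$ even) is the form on $m\mathbb{1}$ whose Gram matrix is the block-diagonal sum of $m/2$ copies of $\begin{bmatrix}0&1\\1&0\end{bmatrix}$. For $y\in\mathbb{K}$, $\beta_P(y)$ is the form on $P$ with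 Gram matrix $\begin{bmatrix}y&1\\1&0\end{bmatrix}$ in the basis $w,\,t.w$. For $i\in\{0,1\}$, $\beta_{2P}(i)$ is the form on $2P$ with Gram matrix $\begin{bmatrix}i&0&0&1\\0&0&1&0\\0&1&0&0\\1&0&0&0\end{bmatrix}$ in a basis $w_1,\,t.w_1,\,w_2,\,t.w_2$. *)

theory Defs
  imports "Jordan_Normal_Form.VS_Connect"
begin

section \<open>The category \<open>Ver\<^sub>4\<^sup>+\<close>\<close>

text \<open>
  A module over \<open>A = K[t]/(t\<^sup>2)\<close> is a \<open>K\<close>-vector space (in the carrier-based sense of
  HOL-Algebra, over the ring record \<^const>\<open>class_ring\<close> of the field type) together with the
  operator \<open>act\<close> by which \<open>t\<close> acts.
\<close>

record ('k, 'v) tmodule = "('k, 'v) module" +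
  act :: "'v \<Rightarrow> 'v"

definition ver4_object :: "('k::field, 'v) tmodule \<Rightarrow> bool" where
  "ver4_object U \<longleftrightarrow>
     vectorspace class_ring U \<and> vectorspace.fin_dim class_ring U \<and>
     act U \<in> LinearCombinations.module_hom class_ring U U \<and>
     (\<forall>u\<in>carrier U. act U (act U u) = \<zero>\<^bsub>U\<^esub>)"

definition ver4_hom :: "('k::field, 'v) tmodule \<Rightarrow> ('k, 'w) tmodule \<Rightarrow> ('v \<Rightarrow> 'w) set" where
  "ver4_hom U V =
     {f \<in> LinearCombinations.module_hom class_ring U V. \<forall>u\<in>carrier U. f (act U u) = act V (f u)}"

definition ver4_iso :: "('k::field, 'v) tmodule \<Rightarrow> ('k, 'w) tmodule \<Rightarrow> ('v \<Rightarrow> 'w) set" where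
  "ver4_iso U V = {f \<in> ver4_hom U V. bij_betw f (carrier U) (carrier V)}"

definition ver4_isomorphic :: "('k::field, 'v) tmodule \<Rightarrow> ('k, 'w) tmodule \<Rightarrow> bool" where
  "ver4_isomorphic U V \<longleftrightarrow> ver4_iso U V \<noteq> {}"

definition ver4_unit :: "('k::field, 'k) tmodule" where
  "ver4_unit = \<lparr>carrier = UNIV, mult = (*), one = 1, zero = 0, add = (+), smult = (*),
     act = (\<lambda>_. 0)\<rparr>"

text \<open>
  The dual object. Functionals are cut off outside the carrier so that they are determined by
  their values on it. The antipode sends \<open>t\<close> to \<open>- t\<close>, which is \<open>t\<close> in characteristic 2.
\<close>

definition ver4_dual :: "('k::field, 'v) tmodule \<Rightarrow> ('k, 'v \<Rightarrow> 'k) tmodule" where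
  "ver4_dual U = \<lparr>
     carrier = LinearCombinations.module_hom class_ring U ver4_unit \<inter> extensional (carrier U),
     mult = undefined, one = undefined,
     zero = (\<lambda>u\<in>carrier U. 0),
     add = (\<lambda>f g. \<lambda>u\<in>carrier U. f u + g u),
     smult = (\<lambda>c f. \<lambda>u\<in>carrier U. c * f u),
     act = (\<lambda>f. \<lambda>u\<in>carrier U. - f (act U u))\<rparr>"

section \<open>Bilinear forms\<close>

text \<open>
  A morphism \<open>U \<otimes> U \<rightarrow> 1\<close> is given by a bilinear map \<open>\<beta>\<close> such that \<open>\<beta> (t.(u \<otimes> v)) = t.\<beta>(u \<otimes> v)\<close>,
  where \<open>t.(u \<otimes> v) = t.u \<otimes> v + u \<otimes> t.v\<close> and \<open>t\<close> acts by 0 on the unit object. In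
  characteristic 2 the last condition says \<open>\<beta> (t.u) v = \<beta> u (t.v)\<close>.
\<close>

definition ver4_bilinear_form :: "('k::field, 'v) tmodule \<Rightarrow> ('v \<Rightarrow> 'v \<Rightarrow> 'k) \<Rightarrow> bool" where
  "ver4_bilinear_form U \<beta> \<longleftrightarrow>
     (\<forall>u\<in>carrier U. (\<lambda>v. \<beta> u v) \<in> LinearCombinations.module_hom class_ring U ver4_unit) \<and>
     (\<forall>v\<in>carrier U. (\<lambda>u. \<beta> u v) \<in> LinearCombinations.module_hom class_ring U ver4_unit) \<and>
     (\<forall>u\<in>carrier U. \<forall>v\<in>carrier U. \<beta> (act U u) v + \<beta> u (act U v) = 0)"

text \<open>
  \<open>\<beta> \<circ> c = \<beta>\<close> evaluated on \<open>u \<otimes> v\<close>, where \<open>c (u \<otimes> v) = v \<otimes> u + t.v \<otimes> t.u\<close>.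
\<close>

definition ver4_symmetric :: "('k::field, 'v) tmodule \<Rightarrow> ('v \<Rightarrow> 'v \<Rightarrow> 'k) \<Rightarrow> bool" where
  "ver4_symmetric U \<beta> \<longleftrightarrow>
     (\<forall>u\<in>carrier U. \<forall>v\<in>carrier U. \<beta> v u + \<beta> (act U v) (act U u) = \<beta> u v)"

definition ver4_nondegenerate :: "('k::field, 'v) tmodule \<Rightarrow> ('v \<Rightarrow> 'v \<Rightarrow> 'k) \<Rightarrow> bool" where
  "ver4_nondegenerate U \<beta> \<longleftrightarrow>
     (\<lambda>u. \<lambda>v\<in>carrier U. \<beta> u v) \<in> ver4_iso U (ver4_dual U)"

definition ver4_form_equiv ::
  "('k::field, 'v) tmodule \<Rightarrow> ('v \<Rightarrow> 'v \<Rightarrow> 'k) \<Rightarrow> ('k, 'w) tmodule \<Rightarrow> ('w \<Rightarrow> 'w \<Rightarrow> 'k) \<Rightarrow> bool" where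
  "ver4_form_equiv U \<beta> U' \<gamma> \<longleftrightarrow>
     (\<exists>\<phi>\<in>ver4_iso U' U. \<forall>u\<in>carrier U'. \<forall>v\<in>carrier U'. \<gamma> u v = \<beta> (\<phi> u) (\<phi> v))"

section \<open>Forms given by matrices\<close>

text \<open>
  Objects with a chosen basis: the space of column vectors on which \<open>t\<close> acts by a square
  matrix \<open>T\<close>. A form on such an object is recorded as a pair \<open>(T, B)\<close>, where \<open>B\<close> is the Gram
  matrix \<open>B\<^sub>i\<^sub>j = \<beta> e\<^sub>i e\<^sub>j\<close>.
\<close>

type_synonym 'k matform = "'k mat \<times> 'k mat"

definition mat_object :: "'k::field mat \<Rightarrow> ('k, 'k vec) tmodule" where
  "mat_object T = \<lparr>carrier = carrier_vec (dim_row T), mult = undefined, one = undefined,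
     zero = 0\<^sub>v (dim_row T), add = (+), smult = (\<cdot>\<^sub>v), act = (\<lambda>v. T *\<^sub>v v)\<rparr>"

definition gram_form :: "'k::field mat \<Rightarrow> 'k vec \<Rightarrow> 'k vec \<Rightarrow> 'k" where
  "gram_form B u v = u \<bullet> (B *\<^sub>v v)"

text \<open>Orthogonal direct sum, and the sum of \<open>k\<close> copies.\<close>

definition form_sum :: "'k::field matform \<Rightarrow> 'k matform \<Rightarrow> 'k matform" (infixr "\<boxplus>" 65) where
  "F \<boxplus> G = (diag_block_mat [fst F, fst G], diag_block_mat [snd F, snd G])"

definition form_copies :: "nat \<Rightarrow> 'k::field matform \<Rightarrow> 'k matform" (infixr "\<boxdot>" 70) where
  "k \<boxdot> F = (diag_block_mat (replicate k (fst F)), diag_block_mat (replicate k (snd F)))"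

text \<open>
  The action of \<open>t\<close> on \<open>P\<close> in the basis \<open>w, t.w\<close>; matrices act on columns, hence the position
  of the 1. The standard object is \<open>m 1 \<oplus> n P\<close>.
\<close>

definition P_act :: "'k::field mat" where
  "P_act = mat_of_rows_list 2 [[0, 0], [1, 0]]"

definition standard_object :: "nat \<Rightarrow> nat \<Rightarrow> ('k::field, 'k vec) tmodule" where
  "standard_object m n = mat_object (diag_block_mat (0\<^sub>m m m # replicate n P_act))"

definition alpha1 :: "nat \<Rightarrow> 'k::field matform" where
  "alpha1 m = (0\<^sub>m m m, 1\<^sub>m m)"

definition alpha2 :: "nat \<Rightarrow> 'k::field matform" where
  "alpha2 m = (0\<^sub>m m m,
     diag_block_mat (replicate (m div 2) (mat_of_rows_list 2 [[0, 1], [1, 0]])))"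

definition beta_P :: "'k::field \<Rightarrow> 'k matform" where
  "beta_P y = (P_act, mat_of_rows_list 2 [[y, 1], [1, 0]])"

definition beta_2P :: "'k::field \<Rightarrow> 'k matform" where
  "beta_2P i = (diag_block_mat [P_act, P_act],
     mat_of_rows_list 4 [[i, 0, 0, 1], [0, 0, 1, 0], [0, 1, 0, 0], [1, 0, 0, 0]])"

definition equivalent_to ::
  "('k::field, 'v) tmodule \<Rightarrow> ('v \<Rightarrow> 'v \<Rightarrow> 'k) \<Rightarrow> 'k matform \<Rightarrow> bool" where
  "equivalent_to U \<beta> F \<longleftrightarrow> ver4_form_equiv U \<beta> (mat_object (fst F)) (gram_form (snd F))"

end

(*
  In characteristic 2 the compatibility of the form with t says that t is self-adjoint, hence
  beta(t u, t v) = beta(u, t t v) = 0 and a symmetric form is symmetric in the ordinary sense.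

  On a nondegenerate t-stable subspace one can always split off an orthogonal summand of one of
  four kinds: a unit vector or a hyperbolic plane if t = 0 on the subspace, and otherwise beta_P(y)
  or a form on 2P, according to whether beta(w, t w) is nonzero for some w.  So every form is a sum
  of such summands.  On U / ker t the induced form (u, v) -> beta(u, t v) and the square root of
  u -> beta(u, u), which is additive and semilinear, drive the normalization: a unit vector absorbs
  the values beta(w, w) and turns hyperbolic planes into unit vectors; a summand beta_P turns a
  neighbouring form on 2P into two more summands beta_P; and two summands beta_P(a^2), beta_P(b^2)
  with a ~= b may be replaced by beta_P(x^2), beta_P((x + a + b)^2) for any x.  The numbers m and n
  are read off from the dimension of the object and the rank of t.
*)

theory Submission
  imports Defs
begin

section \<open>Orthogonal decompositions\<close>

text \<open>A change of basis is verified only through values of \<open>b\<close> and membership in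
  spans. The relations that define a list of atoms already force an invertible Gram matrix, so a
  list of the right length inside \<open>V\<close> that satisfies them is a basis; independence and
  spanning of new vectors come for free. The exchange of two \<open>Single\<close> atoms preserves
  the sum of their parameters and needs them unequal. This separates (E), where all parameters
  agree, from (F), where they can be spread to \<open>0, ..., 0, 1, s\<close>. For n = 2 the value y
  = 1 would be the equal pair 1, 1, which belongs to (E); this is the excluded case in (F). The
  obstacle in (F) is that splitting off a 0 may leave only equal parameters, where the induction
  would stop. A field element other than 0 and 1 gets around it.\<close>

text \<open>
  Labels for the indecomposable summands. \<open>Single s\<close> stands for \<open>\<beta>\<^sub>P(s\<^sup>2)\<close> and \<open>Double i j\<close> for the
  form on \<open>2P\<close> that differs from \<open>\<beta>\<^sub>2\<^sub>P(i\<^sup>2)\<close> only in the value \<open>j\<^sup>2\<close> at \<open>(w\<^sub>2, w\<^sub>2)\<close>; the parameters are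
  square roots, so that they behave additively under a change of basis.
\<close>

datatype 'k atom = Unit | Hyp | Single 'k | Double 'k 'k

text \<open>
  A total vector space keeps membership conditions out of the computations with \<open>b\<close> and \<open>t\<close>; the
  object itself is the subspace \<open>V\<close>, and nothing is assumed about nondegeneracy outside \<open>V\<close>.
\<close>

locale nilpotent_form = vector_space scale
  for scale :: "'k::alg_closed_field \<Rightarrow> 'a::ab_group_add \<Rightarrow> 'a" (infixr "*s" 75) +
  fixes t :: "'a \<Rightarrow> 'a" and b :: "'a \<Rightarrow> 'a \<Rightarrow> 'k" and V :: "'a set"
  assumes char2: "CHAR('k) = 2"
    and t_add: "t (u + v) = t u + t v"
    and t_scale: "t (c *s u) = c *s t u"
    and t_t: "t (t u) = 0"
    and b_add: "b (u + v) w = b u w + b v w"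
    and b_scale: "b (c *s u) w = c * b u w"
    and b_sym: "b u v = b v u"
    and b_t: "b u (t v) = b (t u) v"
    and subspace_V: "subspace V"
    and t_V: "v \<in> V \<Longrightarrow> t v \<in> V"
    and nondegenerate: "v \<in> V \<Longrightarrow> (\<And>u. u \<in> V \<Longrightarrow> b v u = 0) \<Longrightarrow> v = 0"
    and finite_dim: "\<exists>S. finite S \<and> S \<subseteq> V \<and> V \<subseteq> span S"
begin

section \<open>Arithmetic in characteristic 2 and bilinearity\<close>

lemma two_zero [simp]: "(2::'k) = 0"
  using of_nat_CHAR[where 'a='k] by (simp add: char2)

lemma add_self [simp]: "(x::'k) + x = 0"
  by (simp add: mult_2[symmetric])

lemma minus_self [simp]: "- (x::'k) = x"
  using add_self[of x] by (simp add: minus_unique)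

lemma add_self_left [simp]: "(x::'k) + (x + y) = y"
  by (simp add: add.assoc[symmetric])

lemma add_eq_0 [simp]: "(x::'k) + y = 0 \<longleftrightarrow> x = y"
  using add_eq_0_iff[of x y] by auto

lemma square_add: "((x::'k) + y)\<^sup>2 = x\<^sup>2 + y\<^sup>2"
  by (simp add: power2_sum)

lemma square_root: "\<exists>s. s\<^sup>2 = (x::'k)"
  by (rule nth_root_exists) simp

lemma square_eq [simp]: "(x::'k)\<^sup>2 = y\<^sup>2 \<longleftrightarrow> x = y"
  by (simp add: power2_eq_iff)

lemma b_add_right: "b w (u + v) = b w u + b w v"
  by (metis b_add b_sym)

lemma b_scale_right: "b w (c *s u) = c * b w u"
  by (metis b_scale b_sym)

lemma t_zero: "t 0 = 0"
  using t_scale[of 0 0] by simp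

lemma b_zero: "b 0 w = 0"
  using b_scale[of 0 0] by simp

lemma b_zero_right: "b w 0 = 0"
  using b_zero b_sym by metis

lemma t_sum: "t (sum f A) = (\<Sum>i\<in>A. t (f i))"
  by (induction A rule: infinite_finite_induct) (auto simp: t_add t_zero)

lemma b_sum: "b (sum f A) w = (\<Sum>i\<in>A. b (f i) w)"
  by (induction A rule: infinite_finite_induct) (auto simp: b_add b_zero)

lemma b_sum_right: "b w (sum f A) = (\<Sum>i\<in>A. b w (f i))"
  by (simp add: b_sym[of w] b_sum)

lemma V_add: "u \<in> V \<Longrightarrow> v \<in> V \<Longrightarrow> u + v \<in> V"
  and V_scale: "u \<in> V \<Longrightarrow> c *s u \<in> V"
  and V_zero: "0 \<in> V"
  using subspace_V by (auto simp: subspace_def)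

lemma span_V: "S \<subseteq> V \<Longrightarrow> span S \<subseteq> V"
  by (simp add: span_minimal subspace_V)

lemmas bilinear = t_add t_scale t_t t_zero b_add b_scale b_add_right b_scale_right b_zero
  b_zero_right b_t

lemma orthogonal_span:
  assumes "\<And>x. x \<in> S \<Longrightarrow> b v x = 0" and "u \<in> span S"
  shows "b v u = 0"
  using assms(2) by (induction rule: span_induct_alt) (auto simp: bilinear assms(1))

section \<open>Orthogonal lists and their decomposition into atoms\<close>

definition orth :: "'a list \<Rightarrow> 'a list \<Rightarrow> bool" where
  "orth xs ys \<longleftrightarrow> (\<forall>x\<in>set xs. \<forall>y\<in>set ys. b x y = 0)"

text \<open>These values determine the whole Gram matrix: self-adjointness of \<open>t\<close> gives
  \<open>b (t u) (t v) = 0\<close> and \<open>b u (t v) = b (t u) v\<close>, and symmetry gives the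
  rest.\<close>

primrec atom_basis :: "'k atom \<Rightarrow> 'a list \<Rightarrow> bool" where
  "atom_basis Unit xs \<longleftrightarrow> (\<exists>u. xs = [u] \<and> t u = 0 \<and> b u u = 1)"
| "atom_basis Hyp xs \<longleftrightarrow>
     (\<exists>u v. xs = [u, v] \<and> t u = 0 \<and> t v = 0 \<and> b u u = 0 \<and> b v v = 0 \<and> b u v = 1)"
| "atom_basis (Single s) xs \<longleftrightarrow> (\<exists>w. xs = [w, t w] \<and> b w w = s\<^sup>2 \<and> b (t w) w = 1)"
| "atom_basis (Double i j) xs \<longleftrightarrow>
     (\<exists>u v. xs = [u, t u, v, t v] \<and> b u u = i\<^sup>2 \<and> b v v = j\<^sup>2 \<and> b u v = 0 \<and>
        b (t u) u = 0 \<and> b (t v) v = 0 \<and> b (t u) v = 1)"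

primrec dec :: "'k atom list \<Rightarrow> 'a list \<Rightarrow> bool" where
  "dec [] zs \<longleftrightarrow> zs = []"
| "dec (a # as) zs \<longleftrightarrow> (\<exists>xs ys. zs = xs @ ys \<and> atom_basis a xs \<and> dec as ys \<and> orth xs ys)"

lemma orth_append [simp]:
  "orth (xs @ ys) zs \<longleftrightarrow> orth xs zs \<and> orth ys zs"
  "orth zs (xs @ ys) \<longleftrightarrow> orth zs xs \<and> orth zs ys"
  "orth [] zs" "orth zs []"
  by (auto simp: orth_def)

lemma orth_commute: "orth xs ys \<longleftrightarrow> orth ys xs"
  unfolding orth_def using b_sym by metis

lemma orth_set_cong: "set xs = set xs' \<Longrightarrow> orth xs ys \<longleftrightarrow> orth xs' ys"
  by (auto simp: orth_def)

lemma orth_span: "orth xs ys \<Longrightarrow> set xs' \<subseteq> span (set xs) \<Longrightarrow> orth xs' ys"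
  unfolding orth_def by (metis b_sym orthogonal_span subset_iff)

lemma dec_append:
  "dec (as @ bs) zs \<longleftrightarrow> (\<exists>xs ys. zs = xs @ ys \<and> dec as xs \<and> dec bs ys \<and> orth xs ys)"
proof (induction as arbitrary: zs)
  case (Cons a as)
  show ?case (is "?L \<longleftrightarrow> ?R")
  proof
    assume ?L
    then obtain xs ys zs' where "zs = xs @ ys @ zs'" "atom_basis a xs" "dec as ys" "dec bs zs'"
      "orth xs ys" "orth xs zs'" "orth ys zs'" by (auto simp: Cons)
    then show ?R by (intro exI[of _ "xs @ ys"] exI[of _ zs']) auto
  next
    assume ?R
    then obtain xs ys zs' where *: "zs = xs @ ys @ zs'" "atom_basis a xs" "dec as ys" "dec bs zs'"
      "orth xs ys" "orth xs zs'" "orth ys zs'" by auto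
    show ?L unfolding append_Cons dec.simps
      by (intro exI[of _ xs] exI[of _ "ys @ zs'"]) (use * in \<open>auto simp: Cons\<close>)
  qed
qed auto

text \<open>Permuting orthogonal summands only permutes the blocks of the basis. This is what allows
  every exchange below to assume that the atoms concerned head the list.\<close>

lemma dec_mset_cong:
  assumes "mset as = mset bs" and "dec as xs"
  shows "\<exists>ys. dec bs ys \<and> set ys = set xs \<and> length ys = length xs"
  using assms
proof (induction bs arbitrary: as xs)
  case (Cons c bs)
  from Cons.prems(1) have "c \<in> set as" by (metis list.set_intros(1) mset_eq_setD)
  then obtain l r where as: "as = l @ [c] @ r" by (metis append_Cons append_Nil split_list)
  with Cons.prems(2) obtain xl xc xr where *: "xs = xl @ xc @ xr" "dec l xl" "atom_basis c xc"
    "dec r xr" "orth xl xc" "orth xl xr" "orth xc xr"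
    by (auto simp: dec_append)
  then have "dec (l @ r) (xl @ xr)" unfolding dec_append by auto
  moreover have "mset (l @ r) = mset bs" using Cons.prems(1) as by simp
  ultimately obtain ys where ys: "dec bs ys" "set ys = set (xl @ xr)"
    "length ys = length (xl @ xr)" using Cons.IH by blast
  have "orth (xl @ xr) xc" using * orth_commute by auto
  then have "orth xc ys" using orth_set_cong[of ys "xl @ xr" xc] ys(2) orth_commute by blast
  then have "dec (c # bs) (xc @ ys)" using * ys by auto
  moreover have "set (xc @ ys) = set xs" "length (xc @ ys) = length xs" using ys * by auto
  ultimately show ?case by blast
qed auto

section \<open>Unimodular lists\<close>

text \<open>Invertibility of the Gram matrix, phrased as solvability of every system of prescribed
  pairings. In this form it passes to orthogonal unions by adding solutions and yields dual vectors
  and projections directly.\<close>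

definition unimodular :: "'a list \<Rightarrow> bool" where
  "unimodular xs \<longleftrightarrow>
     (\<forall>f. \<exists>z\<in>span (set xs). \<forall>j<length xs. b z (xs ! j) = f j)"

lemma unimodular_append:
  assumes "unimodular xs" "unimodular ys" "orth xs ys"
  shows "unimodular (xs @ ys)"
  unfolding unimodular_def
proof
  fix f
  obtain z where z: "z \<in> span (set xs)" "\<forall>j<length xs. b z (xs ! j) = f j"
    using assms(1) unfolding unimodular_def by blast
  obtain z' where z': "z' \<in> span (set ys)"
      "\<forall>j<length ys. b z' (ys ! j) = f (j + length xs)"
    using assms(2) unfolding unimodular_def
    by (drule_tac spec[where x="\<lambda>j. f (j + length xs)"]) blast
  have 1: "z + z' \<in> span (set (xs @ ys))"
    using z(1) z'(1) span_mono[of "set xs" "set (xs @ ys)"] span_mono[of "set ys" "set (xs @ ys)"]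
    by (auto intro: span_add)
  have 2: "b z y = 0" if "y \<in> set ys" for y
    using assms(3) that orthogonal_span[OF _ z(1), of y] by (auto simp: orth_def b_sym)
  have 3: "b z' x = 0" if "x \<in> set xs" for x
    using assms(3) that orthogonal_span[OF _ z'(1), of x] by (auto simp: orth_def b_sym)
  have "\<forall>j<length (xs @ ys). b (z + z') ((xs @ ys) ! j) = f j"
    using z(2) z'(2) 2 3 by (auto simp: nth_append b_add)
  with 1 show "\<exists>z\<in>span (set (xs @ ys)). \<forall>j<length (xs @ ys). b z ((xs @ ys) ! j) = f j"
    by blast
qed

lemma unimodular_atom:
  assumes "atom_basis a xs"
  shows "unimodular xs"
  unfolding unimodular_def
proof
  fix f
  show "\<exists>z\<in>span (set xs). \<forall>j<length xs. b z (xs ! j) = f j"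
  proof (cases a)
    case Unit
    with assms obtain u where u: "xs = [u]" "b u u = 1" by auto
    show ?thesis
      by (rule bexI[of _ "f 0 *s u"]) (auto simp: u bilinear span_base span_scale)
  next
    case Hyp
    with assms obtain u v where u: "xs = [u, v]" "b u u = 0" "b v v = 0" "b u v = 1" by auto
    have "b v u = 1" using u b_sym by metis
    then have "\<forall>k<length xs. b (f 1 *s u + f 0 *s v) (xs ! k) = f k"
      using u by (auto simp: bilinear less_Suc_eq)
    moreover have "f 1 *s u + f 0 *s v \<in> span (set xs)"
      unfolding u by (intro span_add span_scale span_base) auto
    ultimately show ?thesis by blast
  next
    case (Single s)
    with assms obtain w where w: "xs = [w, t w]" "b w w = s\<^sup>2" "b (t w) w = 1" by auto
    \<comment> \<open>Pairing with \<open>t w\<close> sees only the coefficient of \<open>w\<close>,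
      which must be \<open>f 1\<close>; the coefficient of \<open>t w\<close> then cancels the
      contribution of \<open>b w w\<close>.\<close>
    let ?z = "f 1 *s w + (f 0 + f 1 * s\<^sup>2) *s t w"
    have "\<forall>k<length xs. b ?z (xs ! k) = f k"
      using w by (auto simp: bilinear less_Suc_eq algebra_simps)
    moreover have "?z \<in> span (set xs)"
      unfolding w by (intro span_add span_scale span_base) auto
    ultimately show ?thesis by blast
  next
    case (Double i j)
    with assms obtain u v where u: "xs = [u, t u, v, t v]" "b u u = i\<^sup>2" "b v v = j\<^sup>2"
      "b u v = 0" "b (t u) u = 0" "b (t v) v = 0" "b (t u) v = 1" by auto
    have u': "b v u = 0" "b (t v) u = 1" using u b_sym b_t by metis+
    \<comment> \<open>Same scheme: pairing with \<open>t v\<close> and \<open>t u\<close> fixes the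
      coefficients of \<open>u\<close> and \<open>v\<close>, and the coefficients of
      \<open>t v\<close> and \<open>t u\<close> correct the values at \<open>u\<close> and
      \<open>v\<close>.\<close>
    let ?z = "f 3 *s u + f 1 *s v + (f 0 + f 3 * i\<^sup>2) *s t v + (f 2 + f 1 * j\<^sup>2) *s t u"
    have "\<forall>k<length xs. b ?z (xs ! k) = f k"
      using u u' by (auto simp: bilinear less_Suc_eq algebra_simps numeral_2_eq_2 numeral_3_eq_3)
    moreover have "?z \<in> span (set xs)"
      unfolding u by (intro span_add span_scale span_base) auto
    ultimately show ?thesis by blast
  qed
qed

lemma unimodular_dec: "dec as xs \<Longrightarrow> unimodular xs"
proof (induction as arbitrary: xs)
  case Nil
  then show ?case by (auto simp: unimodular_def intro: span_zero)
next
  case (Cons a as)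
  then show ?case by (auto intro: unimodular_append unimodular_atom)
qed

lemma unimodular_distinct: 
  assumes "unimodular xs"
  shows "distinct xs"
proof (unfold distinct_conv_nth, intro allI impI notI)
  fix i j assume ij: "i < length xs" "j < length xs" "i \<noteq> j" "xs ! i = xs ! j"
  obtain z where "\<forall>k<length xs. b z (xs ! k) = (if k = i then 1 else 0)"
    using assms unfolding unimodular_def
    by (drule_tac spec[where x="\<lambda>k. if k = i then 1 else 0"]) blast
  with ij show False by (metis zero_neq_one)
qed

text \<open>A vector that pairs to 1 with one member and to 0 with all others separates that member
  from the span of the others.\<close>

lemma unimodular_independent:
  assumes "unimodular xs"
  shows "independent (set xs)"
  unfolding dependent_def
proof safe
  fix a assume a: "a \<in> set xs" "a \<in> span (set xs - {a})"
  then obtain i where i: "i < length xs" "a = xs ! i" by (auto simp: in_set_conv_nth)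
  obtain z where z: "\<forall>k<length xs. b z (xs ! k) = (if k = i then 1 else 0)"
    using assms unfolding unimodular_def
    by (drule_tac spec[where x="\<lambda>k. if k = i then 1 else 0"]) blast
  have "b z a = 0"
  proof (rule orthogonal_span[OF _ a(2)])
    fix x assume "x \<in> set xs - {a}"
    then show "b z x = 0" using z i by (auto simp: in_set_conv_nth)
  qed
  with z i show False by simp
qed

lemma unimodular_bound:
  assumes "unimodular xs" "set xs \<subseteq> V"
  shows "length xs \<le> dim V"
proof -
  obtain B where B: "B \<subseteq> V" "independent B" "V \<subseteq> span B" "card B = dim V"
    using basis_exists by blast
  obtain S where S: "finite S" "V \<subseteq> span S" using finite_dim by blast
  have "finite B" using independent_span_bound[OF S(1) B(2)] B(1) S(2) by auto
  then have "card (set xs) \<le> card B"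
    using independent_span_bound[OF _ unimodular_independent[OF assms(1)]] B(3) assms(2) by blast
  then show ?thesis using unimodular_distinct[OF assms(1)] B(4) distinct_card by metis
qed

text \<open>Orthogonal projection: \<open>z\<close> has the same pairings as \<open>v\<close>, and
  \<open>v + z\<close> is \<open>v - z\<close> in characteristic 2.\<close>

lemma unimodular_projection:
  assumes "unimodular xs"
  shows "\<exists>z\<in>span (set xs). \<forall>x\<in>set xs. b (v + z) x = 0"
proof -
  obtain z where "z \<in> span (set xs)" "\<forall>k<length xs. b z (xs ! k) = b v (xs ! k)"
    using assms unfolding unimodular_def
    by (drule_tac spec[where x="\<lambda>k. b v (xs ! k)"]) blast
  then show ?thesis by (intro bexI[of _ z]) (auto simp: b_add in_set_conv_nth)
qed

lemma dec_t_closed: "dec as xs \<Longrightarrow> x \<in> set xs \<Longrightarrow> t x \<in> insert 0 (set xs)"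
proof (induction as arbitrary: xs)
  case (Cons a as)
  then obtain zs ys where *: "xs = zs @ ys" "atom_basis a zs" "dec as ys" by auto
  have "t x \<in> insert 0 (set zs)" if "x \<in> set zs"
    using *(2) that by (cases a) (auto simp: t_t)
  then show ?case using Cons.IH[OF *(3)] Cons.prems(2) *(1) by auto
qed auto

section \<open>Splitting off an atom until \<open>V\<close> is exhausted\<close>

lemma atom_exists:
  assumes "subspace W" and t_W: "\<And>w. w \<in> W \<Longrightarrow> t w \<in> W"
    and nd: "\<And>w. w \<in> W \<Longrightarrow> (\<And>u. u \<in> W \<Longrightarrow> b w u = 0) \<Longrightarrow> w = 0"
    and "w0 \<in> W" "w0 \<noteq> 0"
  shows "\<exists>a zs. atom_basis a zs \<and> set zs \<subseteq> W"
proof -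
  have W: "u + v \<in> W" "c *s u \<in> W" if "u \<in> W" "v \<in> W" for u v c
    using assms(1) that by (auto simp: subspace_def)
  \<comment> \<open>Scaling a vector by \<open>d\<close> multiplies its quadratic values by the
    square of \<open>d\<close>, so square roots suffice to normalize them to 1.\<close>
  have scale: "\<exists>d. d\<^sup>2 * c = 1" if "c \<noteq> 0" for c :: 'k
    using square_root[of "inverse c"] that by (metis left_inverse)
  show ?thesis
  proof (cases "\<forall>w\<in>W. t w = 0")
    case True
    show ?thesis
    proof (cases "\<exists>u\<in>W. b u u \<noteq> 0")
      case t: True
      then obtain u d where u: "u \<in> W" "d\<^sup>2 * b u u = 1" using scale by blast
      then have "atom_basis Unit [d *s u]"
        using True W by (simp add: bilinear power2_eq_square mult.assoc)
      then show ?thesis using u W by (intro exI[of _ Unit] exI[of _ "[d *s u]"]) auto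
    next
      case False
      obtain u where u: "u \<in> W" "b w0 u \<noteq> 0" using assms(4,5) nd by blast
      define v where "v = inverse (b w0 u) *s u"
      have v: "v \<in> W" "b w0 v = 1" using u W by (auto simp: v_def bilinear)
      have "b w0 w0 = 0" "b v v = 0" using False v assms(4) by auto
      with v True assms(4) have "atom_basis Hyp [w0, v]" by auto
      then show ?thesis using v assms(4) by (intro exI[of _ Hyp] exI[of _ "[w0, v]"]) auto
    qed
  next
    case nz: False
    show ?thesis
    proof (cases "\<exists>w\<in>W. b (t w) w \<noteq> 0")
      case True
      then obtain w d where w: "w \<in> W" "d\<^sup>2 * b (t w) w = 1" using scale by blast
      obtain s where s: "s\<^sup>2 = b (d *s w) (d *s w)" using square_root by metis
      have "atom_basis (Single s) [d *s w, t (d *s w)]"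
        using w s by (simp add: bilinear power2_eq_square mult.assoc)
      then show ?thesis using w W t_W
        by (intro exI[of _ "Single s"] exI[of _ "[d *s w, t (d *s w)]"]) auto
    next
      case False
      obtain w where w: "w \<in> W" "t w \<noteq> 0" using nz by blast
      then obtain u' where u': "u' \<in> W" "b (t w) u' \<noteq> 0" using nd t_W by blast
      define v where "v = inverse (b (t w) u') *s u'"
      have v: "v \<in> W" "b (t w) v = 1" using u' W by (auto simp: v_def bilinear)
      \<comment> \<open>Since \<open>b (t w) v = 1\<close>, this multiple of \<open>t w\<close>
        cancels \<open>b w v\<close>, while \<open>t u = t w\<close> keeps all values involving
        \<open>t u\<close>.\<close>
      define u where "u = w + b w v *s t w"
      have u: "u \<in> W" using w t_W W by (auto simp: u_def)
      have z: "b (t w) w = 0" "b (t v) v = 0" using False w v by auto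
      obtain i j where ij: "i\<^sup>2 = b u u" "j\<^sup>2 = b v v" using square_root by metis
      have "b u v = 0" "b (t u) u = 0" "b (t u) v = 1"
        using z v by (auto simp: u_def bilinear)
      then have "atom_basis (Double i j) [u, t u, v, t v]" using ij z by auto
      then show ?thesis using u v t_W
        by (intro exI[of _ "Double i j"] exI[of _ "[u, t u, v, t v]"]) auto
    qed
  qed
qed

text \<open>The orthogonal complement of the part found so far again satisfies the hypotheses of
  \<open>atom_exists\<close>: it is stable because \<open>t\<close> is self-adjoint and maps the
  list into itself or to 0, and nondegenerate because \<open>V\<close> splits.\<close>

lemma dec_extend:
  assumes "dec as xs" "set xs \<subseteq> V" "length xs < dim V"
  shows "\<exists>a zs. dec (a # as) (zs @ xs) \<and> set zs \<subseteq> V \<and> zs \<noteq> []"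
proof -
  define W where "W = {v \<in> V. \<forall>x\<in>set xs. b v x = 0}"
  note um = unimodular_dec[OF assms(1)]
  have sub: "subspace W"
    by (auto simp: subspace_def W_def bilinear V_add V_scale V_zero)
  have tW: "t w \<in> W" if "w \<in> W" for w
  proof -
    have "b (t w) x = 0" if "x \<in> set xs" for x
      using dec_t_closed[OF assms(1) that] \<open>w \<in> W\<close> unfolding b_t[symmetric]
      by (auto simp: W_def b_zero_right)
    then show ?thesis using that by (auto simp: W_def t_V)
  qed
  have orthW: "b w x = 0" if "w \<in> W" "x \<in> span (set xs)" for w x
    using that by (auto simp: W_def intro: orthogonal_span[of "set xs"])
  have split: "\<exists>z\<in>span (set xs). v + z \<in> W" if "v \<in> V" for v
  proof -
    obtain z where z: "z \<in> span (set xs)" "\<forall>x\<in>set xs. b (v + z) x = 0"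
      using unimodular_projection[OF um] by blast
    then show ?thesis using that span_V[OF assms(2)] V_add by (intro bexI[of _ z]) (auto simp: W_def)
  qed
  have nd: "w = 0" if w: "w \<in> W" "\<And>u. u \<in> W \<Longrightarrow> b w u = 0" for w
  \<comment> \<open>An arbitrary test vector of \<open>V\<close> is moved into \<open>W\<close> by
    some \<open>z\<close> in the span of \<open>xs\<close>, to which \<open>w\<close> is
    orthogonal.\<close>
  proof (rule nondegenerate)
    show "w \<in> V" using w by (simp add: W_def)
    fix u assume "u \<in> V"
    then obtain z where "z \<in> span (set xs)" "u + z \<in> W" using split by blast
    then show "b w u = 0" using w(2)[of "u + z"] orthW[OF w(1), of z] by (simp add: b_add_right)
  qed
  have "\<exists>w\<in>W. w \<noteq> 0"
  proof (rule ccontr)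
    assume *: "\<not> ?thesis"
    have "V \<subseteq> span (set xs)"
    proof
      fix v assume "v \<in> V"
      then obtain z where "z \<in> span (set xs)" "v + z = 0" using split * by blast
      then show "v \<in> span (set xs)" by (metis add.inverse_unique minus_minus span_neg)
    qed
    then have "dim V \<le> card (set xs)" by (intro dim_le_card) auto
    with assms(3) card_length[of xs] show False by linarith
  qed
  then obtain w0 where "w0 \<in> W" "w0 \<noteq> 0" by blast
  from atom_exists[OF sub tW nd this] obtain a zs where a: "atom_basis a zs" "set zs \<subseteq> W"
    by blast
  have "orth zs xs" using a(2) by (auto simp: orth_def W_def)
  moreover have "zs \<noteq> []" using a(1) by (cases a) auto
  ultimately show ?thesis using a assms(1) by (intro exI[of _ a] exI[of _ zs]) (auto simp: W_def)
qed

text \<open>Spanning is encoded by the number of vectors, which an exchange visibly preserves; with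
  unimodularity it makes the list a basis of \<open>V\<close>.\<close>

definition full_dec :: "'k atom list \<Rightarrow> bool" where
  "full_dec as \<longleftrightarrow> (\<exists>xs. dec as xs \<and> set xs \<subseteq> V \<and> length xs = dim V)"

lemma full_dec_exists: "\<exists>as. full_dec as"
proof -
  have "\<exists>as. full_dec as" if "dec as xs" "set xs \<subseteq> V" for as xs
    using that
  proof (induction "dim V - length xs" arbitrary: as xs rule: less_induct)
    case less
    note le = unimodular_bound[OF unimodular_dec[OF less.prems(1)] less.prems(2)]
    show ?case
    proof (cases "length xs = dim V")
      case True
      with less.prems show ?thesis unfolding full_dec_def by blast
    next
      case False
      with le obtain a zs where *: "dec (a # as) (zs @ xs)" "set zs \<subseteq> V" "zs \<noteq> []"
        using dec_extend[OF less.prems] by auto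
      moreover have "dim V - length (zs @ xs) < dim V - length xs"
        using * False le by (cases zs) auto
      ultimately show ?thesis using less.hyps[of "zs @ xs" "a # as"] less.prems by auto
    qed
  qed
  from this[of "[]" "[]"] show ?thesis by simp
qed

lemma full_dec_cong: "full_dec as \<Longrightarrow> mset as = mset bs \<Longrightarrow> full_dec bs"
  unfolding full_dec_def by (metis dec_mset_cong)

text \<open>Containment in the old span gives both orthogonality to the untouched atoms and
  membership in \<open>V\<close>.\<close>

lemma full_dec_replace:
  assumes "full_dec (as @ rest)"
    and "\<And>xs. dec as xs \<Longrightarrow> \<exists>ys. dec bs ys \<and> set ys \<subseteq> span (set xs) \<and> length ys = length xs"
  shows "full_dec (bs @ rest)"
proof -
  obtain xs zs where *: "dec as xs" "dec rest zs" "orth xs zs" "set (xs @ zs) \<subseteq> V"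
    "length (xs @ zs) = dim V"
    using assms(1) unfolding full_dec_def dec_append by blast
  obtain ys where ys: "dec bs ys" "set ys \<subseteq> span (set xs)" "length ys = length xs"
    using assms(2)[OF *(1)] by blast
  have "dec (bs @ rest) (ys @ zs)" unfolding dec_append
    using * ys orth_span[OF *(3) ys(2)] by blast
  moreover have "set (ys @ zs) \<subseteq> V" using ys *(4) span_V[of "set xs"] by auto
  ultimately show ?thesis unfolding full_dec_def using *(5) ys(3) by (intro exI[of _ "ys @ zs"]) auto
qed


lemma dec_NilI: "dec [] []"
  by simp

lemma dec_UnitI:
  assumes "t u = 0" "b u u = 1" "dec as ys" "\<forall>y\<in>set ys. b u y = 0"
  shows "dec (Unit # as) (u # ys)"
  unfolding dec.simps
  by (rule exI[of _ "[u]"], rule exI[of _ ys]) (use assms in \<open>auto simp: orth_def\<close>)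

lemma dec_SingleI:
  assumes "b w w = s\<^sup>2" "b (t w) w = 1" "dec as ys" "\<forall>y\<in>set ys. b w y = 0 \<and> b (t w) y = 0"
  shows "dec (Single s # as) (w # t w # ys)"
  unfolding dec.simps
  by (rule exI[of _ "[w, t w]"], rule exI[of _ ys]) (use assms in \<open>auto simp: orth_def\<close>)

lemma dec_DoubleI:
  assumes "b u u = i\<^sup>2" "b v v = j\<^sup>2" "b u v = 0" "b (t u) u = 0" "b (t v) v = 0" "b (t u) v = 1"
    and "dec as ys" "\<forall>y\<in>set ys. b u y = 0 \<and> b (t u) y = 0 \<and> b v y = 0 \<and> b (t v) y = 0"
  shows "dec (Double i j # as) (u # t u # v # t v # ys)"
  unfolding dec.simps
  by (rule exI[of _ "[u, t u, v, t v]"], rule exI[of _ ys]) (use assms in \<open>auto simp: orth_def\<close>)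

lemmas dec_intros = dec_NilI dec_UnitI dec_SingleI dec_DoubleI

section \<open>Exchange of summands\<close>

text \<open>
  In the new bases below \<open>y\<close> is made orthogonal to \<open>x\<close> by adding \<open>b x y *s t z\<close>, where
  \<open>b x (t z) = 1\<close>. This keeps \<open>t y\<close>, and also \<open>b y y\<close>, as the cross term occurs twice and
  \<open>b (t z) (t z) = 0\<close>.
\<close>

lemma replace_Unit_Hyp:
  assumes "full_dec (Unit # Hyp # rest)"
  shows "full_dec (Unit # Unit # Unit # rest)"
proof -
  have "full_dec ([Unit, Unit, Unit] @ rest)"
  proof (rule full_dec_replace[of "[Unit, Hyp]"])
    show "full_dec ([Unit, Hyp] @ rest)" using assms by simp
    fix xs assume "dec [Unit, Hyp] xs"
    then obtain u x y where *: "xs = [u, x, y]" "t u = 0" "t x = 0" "t y = 0"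
      "b u u = 1" "b x x = 0" "b y y = 0" "b x y = 1" "b u x = 0" "b u y = 0"
      by (auto simp: orth_def)
    then have "b y x = 1" "b x u = 0" "b y u = 0" by (metis b_sym)+
    \<comment> \<open>Each mixed product is \<open>1 + 1\<close>, one term from \<open>u\<close> and
      one from the hyperbolic pair.\<close>
    with * have "dec [Unit, Unit, Unit] [u + x, u + y, u + x + y]"
      by (intro dec_intros) (auto simp: bilinear)
    moreover have "set [u + x, u + y, u + x + y] \<subseteq> span (set xs)"
      unfolding * by (auto intro!: span_add simp: span_base)
    ultimately show "\<exists>ys. dec [Unit, Unit, Unit] ys \<and> set ys \<subseteq> span (set xs) \<and> length ys = length xs"
      using * by (intro exI[of _ "[u + x, u + y, u + x + y]"]) auto
  qed
  then show ?thesis by simp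
qed

lemma replace_Unit_Single:
  assumes "full_dec (Unit # Single s # rest)"
  shows "full_dec (Unit # Single 0 # rest)"
proof -
  have "full_dec ([Unit, Single 0] @ rest)"
  proof (rule full_dec_replace[of "[Unit, Single s]"])
    show "full_dec ([Unit, Single s] @ rest)" using assms by simp
    fix xs assume "dec [Unit, Single s] xs"
    then obtain u w where *: "xs = [u, w, t w]" "t u = 0" "b u u = 1" "b w w = s\<^sup>2"
      "b (t w) w = 1" "b u w = 0"
      by (auto simp: orth_def)
    then have "b w u = 0" "b (t w) u = 0" by (metis b_sym b_t b_zero)+
    \<comment> \<open>Adding \<open>s *s u\<close> cancels \<open>b w w\<close>, but creates the
      product \<open>s\<close> with \<open>u\<close>; adding \<open>s *s t w\<close> to
      \<open>u\<close> removes it without changing \<open>b u u\<close>.\<close>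
    moreover define u' w' where "u' = u + s *s t w" and "w' = w + s *s u"
    ultimately have "dec [Unit, Single 0] [u', w', t w']"
      using * by (intro dec_intros) (auto simp: bilinear power2_eq_square)
    moreover have "set [u', w', t w'] \<subseteq> span (set xs)"
      unfolding * u'_def w'_def t_add t_scale
      by (auto intro!: span_add span_scale simp: * span_base span_zero)
    ultimately show "\<exists>ys. dec [Unit, Single 0] ys \<and> set ys \<subseteq> span (set xs) \<and> length ys = length xs"
      using * by (intro exI[of _ "[u', w', t w']"]) auto
  qed
  then show ?thesis by simp
qed

lemma replace_Unit_Double:
  assumes "full_dec (Unit # Double i j # rest)"
  shows "full_dec (Unit # Double 0 0 # rest)"
proof -
  have "full_dec ([Unit, Double 0 0] @ rest)"
  proof (rule full_dec_replace[of "[Unit, Double i j]"])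
    show "full_dec ([Unit, Double i j] @ rest)" using assms by simp
    fix xs assume "dec [Unit, Double i j] xs"
    then obtain z u v where *: "xs = [z, u, t u, v, t v]" "t z = 0" "b z z = 1" "b u u = i\<^sup>2"
      "b v v = j\<^sup>2" "b u v = 0" "b (t u) u = 0" "b (t v) v = 0" "b (t u) v = 1" "b z u = 0" "b z v = 0"
      by (auto simp: orth_def)
    then have "b v u = 0" "b (t v) u = 1" "b u z = 0" "b v z = 0" "b (t u) z = 0" "b (t v) z = 0"
      by (metis b_sym b_t b_zero)+
    \<comment> \<open>The multiples of \<open>z\<close> cancel \<open>b u u\<close> and
      \<open>b v v\<close>. They create \<open>b u v = i * j\<close>, removed by the term in
      \<open>t u\<close> of \<open>u'\<close>, and the products \<open>i\<close>, \<open>j\<close>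
      with \<open>z\<close>, removed by the terms of \<open>z'\<close>.\<close>
    moreover define z' u' v' where "z' = z + i *s t v + j *s t u"
      and "u' = u + i *s z + (i * j) *s t u" and "v' = v + j *s z"
    ultimately have "dec [Unit, Double 0 0] [z', u', t u', v', t v']"
      using * by (intro dec_intros) (auto simp: bilinear power2_eq_square algebra_simps)
    moreover have "set [z', u', t u', v', t v'] \<subseteq> span (set xs)"
      unfolding * z'_def u'_def v'_def t_add t_scale t_t
      by (auto intro!: span_add span_scale simp: * span_base span_zero)
    ultimately show "\<exists>ys. dec [Unit, Double 0 0] ys \<and> set ys \<subseteq> span (set xs) \<and> length ys = length xs"
      using * by (intro exI[of _ "[z', u', t u', v', t v']"]) auto
  qed
  then show ?thesis by simp
qed

text \<open>On \<open>V / ker t\<close> with the form \<open>b u (t v)\<close>, a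
  \<open>Single\<close> is a unit vector and a \<open>Double\<close> a hyperbolic plane, so the
  three sums from \<open>replace_Unit_Hyp\<close> work again. Their parameters add, as the square
  root of \<open>b u u\<close> is additive. The remaining terms in \<open>t x\<close> and
  \<open>t y\<close> restore orthogonality for \<open>b\<close>.\<close>

lemma replace_Single_Double:
  assumes "full_dec (Single a # Double i j # rest)"
  shows "full_dec (Single (a + i) # Single (a + j) # Single (a + i + j) # rest)"
proof -
  let ?bs = "[Single (a + i), Single (a + j), Single (a + i + j)]"
  have "full_dec (?bs @ rest)"
  proof (rule full_dec_replace[of "[Single a, Double i j]"])
    show "full_dec ([Single a, Double i j] @ rest)" using assms by simp
    fix xs assume "dec [Single a, Double i j] xs"
    then obtain w u v where *: "xs = [w, t w, u, t u, v, t v]" "b w w = a\<^sup>2" "b (t w) w = 1"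
      "b u u = i\<^sup>2" "b v v = j\<^sup>2" "b u v = 0" "b (t u) u = 0" "b (t v) v = 0" "b (t u) v = 1"
      "b w u = 0" "b w v = 0" "b (t w) u = 0" "b (t w) v = 0"
      by (auto simp: orth_def)
    then have **: "b v u = 0" "b (t v) u = 1" "b u w = 0" "b v w = 0" "b (t u) w = 0" "b (t v) w = 0"
      by (metis b_sym b_t)+
    define x where "x = w + u"
    define y where "y = w + v + a\<^sup>2 *s t x"
    define z where "z = w + u + v + (a\<^sup>2 + i\<^sup>2) *s t x + (a\<^sup>2 + j\<^sup>2) *s t y"
    have dec: "dec ?bs [x, t x, y, t y, z, t z]"
      using * ** by (intro dec_intros) (auto simp: x_def y_def z_def bilinear square_add algebra_simps)
    have x: "x \<in> span (set xs)" "t x \<in> span (set xs)"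
      unfolding * x_def t_add by (auto intro!: span_add simp: span_base)
    then have y: "y \<in> span (set xs)" "t y \<in> span (set xs)"
      unfolding y_def t_add t_scale t_t using *(1) by (auto intro!: span_add span_scale simp: span_base)
    with x have "z \<in> span (set xs)" "t z \<in> span (set xs)"
      unfolding z_def t_add t_scale t_t using *(1) by (auto intro!: span_add span_scale simp: span_base)
    with x y dec show "\<exists>ys. dec ?bs ys \<and> set ys \<subseteq> span (set xs) \<and> length ys = length xs"
      using *(1) by (intro exI[of _ "[x, t x, y, t y, z, t z]"]) auto
  qed
  then show ?thesis by simp
qed

lemma replace_Double_swap:
  assumes "full_dec (Double i j # rest)"
  shows "full_dec (Double j i # rest)"
proof -
  have "full_dec ([Double j i] @ rest)"
  proof (rule full_dec_replace[of "[Double i j]"])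
    show "full_dec ([Double i j] @ rest)" using assms by simp
    fix xs assume "dec [Double i j] xs"
    then obtain u v where *: "xs = [u, t u, v, t v]" "b u u = i\<^sup>2"
      "b v v = j\<^sup>2" "b u v = 0" "b (t u) u = 0" "b (t v) v = 0" "b (t u) v = 1"
      by (auto simp: orth_def)
    then have "b v u = 0" "b (t v) u = 1" by (metis b_sym b_t)+
    with * have "dec [Double j i] [v, t v, u, t u]" by (intro dec_intros) auto
    then show "\<exists>ys. dec [Double j i] ys \<and> set ys \<subseteq> span (set xs) \<and> length ys = length xs"
      using * by (intro exI[of _ "[v, t v, u, t u]"]) (auto simp: span_base)
  qed
  then show ?thesis by simp
qed

text \<open>The square roots of \<open>b u u\<close> and \<open>b v v\<close> are \<open>i\<close>
  and \<open>j\<close>, so the semilinear map they come from vanishes on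
  \<open>i *s v + j *s u\<close>. This vector, corrected by a multiple of its image under
  \<open>t\<close>, is the partner of \<open>inverse i *s u\<close>.\<close>

lemma replace_Double_normalize:
  assumes "full_dec (Double i j # rest)" "i \<noteq> 0"
  shows "full_dec (Double 1 0 # rest)"
proof -
  have "full_dec ([Double 1 0] @ rest)"
  proof (rule full_dec_replace[of "[Double i j]"])
    show "full_dec ([Double i j] @ rest)" using assms by simp
    fix xs assume "dec [Double i j] xs"
    then obtain u v where *: "xs = [u, t u, v, t v]" "b u u = i\<^sup>2"
      "b v v = j\<^sup>2" "b u v = 0" "b (t u) u = 0" "b (t v) v = 0" "b (t u) v = 1"
      by (auto simp: orth_def)
    then have **: "b v u = 0" "b (t v) u = 1" by (metis b_sym b_t)+
    define x where "x = inverse i *s u"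
    define y where "y = i *s v + j *s u + (i * j) *s (i *s t v + j *s t u)"
    have "dec [Double 1 0] [x, t x, y, t y]"
      using * ** assms(2)
      by (intro dec_intros) (auto simp: x_def y_def bilinear power2_eq_square algebra_simps)
    moreover have "set [x, t x, y, t y] \<subseteq> span (set xs)"
      unfolding * x_def y_def t_add t_scale t_t
      by (auto intro!: span_add span_scale simp: span_base span_zero)
    ultimately show "\<exists>ys. dec [Double 1 0] ys \<and> set ys \<subseteq> span (set xs) \<and> length ys = length xs"
      using * by (intro exI[of _ "[x, t x, y, t y]"]) auto
  qed
  then show ?thesis by simp
qed

lemma replace_Double_Double:
  assumes "full_dec (Double 1 0 # Double 1 0 # rest)"
  shows "full_dec (Double 1 0 # Double 0 0 # rest)"
proof -
  have "full_dec ([Double 1 0, Double 0 0] @ rest)"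
  proof (rule full_dec_replace[of "[Double 1 0, Double 1 0]"])
    show "full_dec ([Double 1 0, Double 1 0] @ rest)" using assms by simp
    fix xs assume "dec [Double 1 0, Double 1 0] xs"
    then obtain u v x y where *: "xs = [u, t u, v, t v, x, t x, y, t y]" "b u u = 1" "b v v = 0"
      "b u v = 0" "b (t u) u = 0" "b (t v) v = 0" "b (t u) v = 1"
      "b x x = 1" "b y y = 0" "b x y = 0" "b (t x) x = 0" "b (t y) y = 0" "b (t x) y = 1"
      "b u x = 0" "b u y = 0" "b v x = 0" "b v y = 0"
      "b (t u) x = 0" "b (t u) y = 0" "b (t v) x = 0" "b (t v) y = 0"
      by (auto simp: orth_def)
    then have **: "b v u = 0" "b (t v) u = 1" "b y x = 0" "b (t y) x = 1"
      "b x u = 0" "b y u = 0" "b x v = 0" "b y v = 0"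
      "b (t x) u = 0" "b (t y) u = 0" "b (t x) v = 0" "b (t y) v = 0"
      by (metis b_sym b_t)+
    \<comment> \<open>\<open>x + u\<close> has square value \<open>1 + 1 = 0\<close>. It pairs with
      \<open>t v\<close>, so \<open>v\<close> becomes \<open>v + y\<close>, where the two
      contributions cancel; \<open>t v + t y\<close> in \<open>x'\<close> cancels
      \<open>b x u + b u u = 1\<close>.\<close>
    define v' where "v' = v + y"
    define x' where "x' = x + u + t v + t y"
    have "dec [Double 1 0, Double 0 0] [u, t u, v', t v', x', t x', y, t y]"
      using * ** by (intro dec_intros) (auto simp: x'_def v'_def bilinear)
    moreover have "set [u, t u, v', t v', x', t x', y, t y] \<subseteq> span (set xs)"
      unfolding * x'_def v'_def t_add t_scale t_t
      by (auto intro!: span_add span_scale simp: span_base span_zero)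
    ultimately show "\<exists>ys. dec [Double 1 0, Double 0 0] ys \<and> set ys \<subseteq> span (set xs) \<and> length ys = length xs"
      using * by (intro exI[of _ "[u, t u, v', t v', x', t x', y, t y]"]) auto
  qed
  then show ?thesis by simp
qed

text \<open>In characteristic 2 the matrix with rows \<open>(1 + c, c)\<close> and
  \<open>(c, 1 + c)\<close> is orthogonal for every \<open>c\<close>, so it preserves the form
  \<open>b u (t v)\<close>. It moves the first parameter to \<open>a + c * (a + d)\<close>, and
  \<open>c\<close> is solved from this being \<open>x\<close>, which requires
  \<open>a \<noteq> d\<close>.\<close>

lemma replace_Single_Single:
  assumes "full_dec (Single a # Single d # rest)" "a \<noteq> d"
  shows "full_dec (Single x # Single (x + a + d) # rest)"
proof -
  define c where "c = (x + a) / (a + d)"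
  have c: "c * a + c * d = x + a"
  proof -
    have "c * (a + d) = x + a" using assms(2) by (simp add: c_def)
    then show ?thesis by (simp add: distrib_left)
  qed
  let ?bs = "[Single x, Single (x + a + d)]"
  have "full_dec (?bs @ rest)"
  proof (rule full_dec_replace[of "[Single a, Single d]"])
    show "full_dec ([Single a, Single d] @ rest)" using assms by simp
    fix xs assume "dec [Single a, Single d] xs"
    then obtain w v where *: "xs = [w, t w, v, t v]" "b w w = a\<^sup>2" "b (t w) w = 1"
      "b v v = d\<^sup>2" "b (t v) v = 1" "b w v = 0" "b (t w) v = 0"
      by (auto simp: orth_def)
    then have **: "b v w = 0" "b (t v) w = 0" by (metis b_sym b_t)+
    define y where "y = (1 + c) *s w + c *s v"
    define z where "z = c *s w + (1 + c) *s v + (c * (1 + c) * (a\<^sup>2 + d\<^sup>2)) *s t y"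
    have x: "a + (c * a + c * d) = x" "d + (c * a + c * d) = x + a + d"
      unfolding c by (simp_all add: algebra_simps)
    have "b y y = (a + (c * a + c * d))\<^sup>2"
      using * ** by (simp add: y_def bilinear square_add power_mult_distrib power2_eq_square algebra_simps)
    moreover have "b z z = (d + (c * a + c * d))\<^sup>2"
      using * ** by (simp add: y_def z_def bilinear square_add power_mult_distrib power2_eq_square algebra_simps)
    moreover have "b (t y) y = 1" "b (t z) z = 1" "b y z = 0" "b (t y) z = 0"
      using * ** by (simp_all add: y_def z_def bilinear power2_eq_square algebra_simps)
    ultimately have dec: "dec ?bs [y, t y, z, t z]"
      unfolding x by (intro dec_intros) (auto simp: b_t t_t b_zero)
    have y: "y \<in> span (set xs)" "t y \<in> span (set xs)"
      unfolding * y_def t_add t_scale by (auto intro!: span_add span_scale simp: span_base)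
    then have "z \<in> span (set xs)" "t z \<in> span (set xs)"
      unfolding z_def t_add t_scale t_t using *(1) by (auto intro!: span_add span_scale simp: span_base)
    with y dec show "\<exists>ys. dec ?bs ys \<and> set ys \<subseteq> span (set xs) \<and> length ys = length xs"
      using *(1) by (intro exI[of _ "[y, t y, z, t z]"]) auto
  qed
  then show ?thesis by simp
qed


section \<open>Normal forms\<close>

text \<open>A distinguished head \<open>h\<close> meets the other atoms one by one, turning each
  into atoms from \<open>R\<close> and possibly changing itself within \<open>H\<close>.\<close>

lemma full_dec_eliminate:
  assumes step: "\<And>h a rest. h \<in> H \<Longrightarrow> a \<in> Q \<Longrightarrow> full_dec (h @ a # rest) \<Longrightarrow>
      \<exists>h'\<in>H. \<exists>cs. set cs \<subseteq> R \<and> full_dec (h' @ cs @ rest)"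
    and "h \<in> H" "set as \<subseteq> Q" "full_dec (h @ as)"
  shows "\<exists>h'\<in>H. \<exists>bs. set bs \<subseteq> R \<and> full_dec (h' @ bs)"
proof -
  have "\<exists>h'\<in>H. \<exists>bs. set bs \<subseteq> R \<and> full_dec (h' @ bs)"
    if "h \<in> H" "set as \<subseteq> Q" "set bs \<subseteq> R" "full_dec (h @ as @ bs)" for h as bs
    using that
  proof (induction as arbitrary: h bs)
    case (Cons a as)
    then obtain h' cs where h': "h' \<in> H" "set cs \<subseteq> R" "full_dec (h' @ cs @ as @ bs)"
      using step[of h a "as @ bs"] by auto
    \<comment> \<open>The products \<open>cs\<close> join the finished atoms \<open>bs\<close>
      behind the unprocessed ones.\<close>
    have "full_dec (h' @ as @ cs @ bs)" by (rule full_dec_cong[OF h'(3)]) simp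
    with Cons.IH[of h' "cs @ bs"] Cons.prems h' show ?case by auto
  qed auto
  from this[of h as "[]"] assms show ?thesis by simp
qed

lemma mset_two_values:
  assumes "set bs \<subseteq> {x, y}"
  shows "\<exists>k l. mset bs = mset (replicate k x @ replicate l y)"
  using assms
proof (induction bs)
  case Nil
  then show ?case by (intro exI[of _ 0]) simp
next
  case (Cons c bs)
  then obtain k l where *: "mset bs = mset (replicate k x @ replicate l y)" by auto
  from Cons.prems consider "c = x" | "c = y" by auto
  then show ?case
  proof cases
    case 1
    then show ?thesis using * by (intro exI[of _ "Suc k"] exI[of _ l]) auto
  next
    case 2
    then show ?thesis using * by (intro exI[of _ k] exI[of _ "Suc l"]) auto
  qed
qed

lemma full_dec_two_values:
  assumes "full_dec (h @ bs)" "set bs \<subseteq> {x, y}"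
  shows "\<exists>k l. full_dec (h @ replicate k x @ replicate l y)"
proof -
  obtain k l where "mset bs = mset (replicate k x @ replicate l y)"
    using mset_two_values[OF assms(2)] by blast
  then show ?thesis using full_dec_cong[OF assms(1)] by (intro exI[of _ k] exI[of _ l]) auto
qed

lemma normal_form_Unit:
  assumes "full_dec as" "Unit \<in> set as"
  shows "\<exists>k l. full_dec (replicate (Suc k) Unit @ replicate l (Double 0 0)) \<or>
    (full_dec (replicate (Suc k) Unit @ replicate (Suc l) (Single 0)))"
proof -
  obtain l r where as: "as = l @ Unit # r" using assms(2) by (meson split_list)
  have "full_dec ([Unit] @ l @ r)" by (rule full_dec_cong[OF assms(1)]) (simp add: as)
  then have "\<exists>h'\<in>{[Unit]}. \<exists>bs. set bs \<subseteq> {Unit, Single 0, Double 0 0} \<and> full_dec (h' @ bs)"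
  proof (rule full_dec_eliminate[where Q = UNIV and h = "[Unit]", rotated 3])
    fix h a rest assume *: "h \<in> {[Unit]}" "full_dec (h @ a # rest)"
    show "\<exists>h'\<in>{[Unit]}. \<exists>cs. set cs \<subseteq> {Unit, Single 0, Double 0 0} \<and> full_dec (h' @ cs @ rest)"
    proof (cases a)
      case Unit
      with * show ?thesis by (intro bexI[of _ "[Unit]"] exI[of _ "[Unit]"]) auto
    next
      case Hyp
      with * replace_Unit_Hyp show ?thesis
        by (intro bexI[of _ "[Unit]"] exI[of _ "[Unit, Unit]"]) auto
    next
      case (Single s)
      with * replace_Unit_Single show ?thesis
        by (intro bexI[of _ "[Unit]"] exI[of _ "[Single 0]"]) auto
    next
      case (Double i j)
      with * replace_Unit_Double show ?thesis
        by (intro bexI[of _ "[Unit]"] exI[of _ "[Double 0 0]"]) auto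
    qed
  qed auto
  then obtain bs where bs: "set bs \<subseteq> {Unit, Single 0, Double 0 0}" "full_dec (Unit # bs)" by auto
  show ?thesis
  proof (cases "Single 0 \<in> set bs")
    case False
    then have "set bs \<subseteq> {Unit, Double 0 0}" using bs(1) by auto
    then obtain k l where "full_dec ([Unit] @ replicate k Unit @ replicate l (Double 0 0))"
      using full_dec_two_values[of "[Unit]" bs Unit "Double 0 0"] bs(2) by auto
    then show ?thesis by auto
  next
    case True
    then obtain l r where as: "bs = l @ Single 0 # r" by (meson split_list)
    \<comment> \<open>A single \<open>Single 0\<close> converts every \<open>Double 0 0\<close> into
      two more copies of itself. The \<open>Unit\<close> is kept in the head to guarantee m >
      0.\<close>
    have "full_dec ([Single 0] @ Unit # l @ r)" by (rule full_dec_cong[OF bs(2)]) (simp add: as)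
    then have "full_dec ([Single 0, Unit] @ l @ r)" by simp
    then have "\<exists>h'\<in>{[Single 0, Unit]}. \<exists>bs. set bs \<subseteq> {Unit, Single 0} \<and> full_dec (h' @ bs)"
    proof (rule full_dec_eliminate[where Q = "{Unit, Single 0, Double 0 0}" and
          h = "[Single 0, Unit]", rotated 3])
      fix h a rest
      assume *: "h \<in> {[Single 0, Unit]}" "full_dec (h @ a # rest)" "a \<in> {Unit, Single 0, Double 0 0}"
      from *(3) consider "a \<in> {Unit, Single 0}" | "a = Double 0 0" by auto
      then show "\<exists>h'\<in>{[Single 0, Unit]}. \<exists>cs. set cs \<subseteq> {Unit, Single 0} \<and> full_dec (h' @ cs @ rest)"
      proof cases
        case 1
        with * show ?thesis by (intro bexI[of _ "[Single 0, Unit]"] exI[of _ "[a]"]) auto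
      next
        case 2
        have "full_dec (Single 0 # Double 0 0 # Unit # rest)"
          by (rule full_dec_cong[OF *(2)]) (use * 2 in simp)
        from full_dec_cong[OF replace_Single_Double[OF this]]
        have "full_dec ([Single 0, Unit] @ [Single 0, Single 0] @ rest)"
          by simp
        then show ?thesis by (intro bexI[of _ "[Single 0, Unit]"] exI[of _ "[Single 0, Single 0]"]) auto
      qed
    qed (use bs(1) as in auto)
    then obtain cs where "set cs \<subseteq> {Unit, Single 0}" "full_dec ([Single 0, Unit] @ cs)" by auto
    then obtain k l where "full_dec ([Single 0, Unit] @ replicate k Unit @ replicate l (Single 0))"
      using full_dec_two_values by blast
    then have "full_dec (replicate (Suc k) Unit @ replicate (Suc l) (Single 0))"
      by (rule full_dec_cong) simp
    then show ?thesis by blast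
  qed
qed

text \<open>Each \<open>Double\<close> is first brought to parameters 0, 0 or 1, 0; then one
  \<open>Double 1 0\<close>, if present, serves as head and clears the parameters of all
  others.\<close>

lemma normal_form_Double:
  assumes "full_dec as" "set as \<subseteq> insert Hyp (range (\<lambda>(i, j). Double i j))"
  shows "\<exists>k l. full_dec (replicate k Hyp @ replicate l (Double 0 0)) \<or>
    full_dec (replicate k Hyp @ Double 1 0 # replicate l (Double 0 0))"
proof -
  have "\<exists>h'\<in>{[]}. \<exists>bs. set bs \<subseteq> {Hyp, Double 0 0, Double 1 0} \<and> full_dec (h' @ bs)"
  proof (rule full_dec_eliminate[where Q = "insert Hyp (range (\<lambda>(i, j). Double i j))" and h = "[]"])
    fix h a rest
    assume *: "h \<in> {[]}" "a \<in> insert Hyp (range (\<lambda>(i, j). Double i j))" "full_dec (h @ a # rest)"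
    from *(2) consider "a \<in> {Hyp, Double 0 0}" | i j where "a = Double i j" "i \<noteq> 0 \<or> j \<noteq> 0" by auto
    then show "\<exists>h'\<in>{[]}. \<exists>cs. set cs \<subseteq> {Hyp, Double 0 0, Double 1 0} \<and> full_dec (h' @ cs @ rest)"
    proof cases
      case 1
      with * show ?thesis by (auto intro!: exI[of _ "[a]"])
    next
      case 2
      with * have "full_dec (Double i j # rest)" by simp
      then have "full_dec (Double 1 0 # rest)"
        using replace_Double_normalize replace_Double_swap 2(2) by metis
      then show ?thesis by (auto intro!: exI[of _ "[Double 1 0]"])
    qed
  qed (use assms in auto)
  then obtain bs where bs: "set bs \<subseteq> {Hyp, Double 0 0, Double 1 0}" "full_dec bs" by auto
  show ?thesis
  proof (cases "Double 1 0 \<in> set bs")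
    case False
    then have "set bs \<subseteq> {Hyp, Double 0 0}" using bs(1) by auto
    then obtain k l where "full_dec ([] @ replicate k Hyp @ replicate l (Double 0 0))"
      using full_dec_two_values[of "[]" bs Hyp "Double 0 0"] bs(2) by auto
    then show ?thesis by auto
  next
    case True
    then obtain l r where as: "bs = l @ Double 1 0 # r" by (meson split_list)
    have "full_dec ([Double 1 0] @ l @ r)" by (rule full_dec_cong[OF bs(2)]) (simp add: as)
    then have "\<exists>h'\<in>{[Double 1 0]}. \<exists>bs. set bs \<subseteq> {Hyp, Double 0 0} \<and> full_dec (h' @ bs)"
    proof (rule full_dec_eliminate[where Q = "{Hyp, Double 0 0, Double 1 0}" and
          h = "[Double 1 0]", rotated 3])
      fix h a rest
      assume *: "h \<in> {[Double 1 0]}" "a \<in> {Hyp, Double 0 0, Double 1 0}" "full_dec (h @ a # rest)"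
      from *(2) consider "a \<in> {Hyp, Double 0 0}" | "a = Double 1 0" by auto
      then show "\<exists>h'\<in>{[Double 1 0]}. \<exists>cs. set cs \<subseteq> {Hyp, Double 0 0} \<and> full_dec (h' @ cs @ rest)"
      proof cases
        case 1
        with * show ?thesis by (auto intro!: exI[of _ "[a]"])
      next
        case 2
        with * have "full_dec (Double 1 0 # Double 0 0 # rest)"
          using replace_Double_Double by auto
        then show ?thesis by (auto intro!: exI[of _ "[Double 0 0]"])
      qed
    qed (use bs(1) as in auto)
    then obtain cs where "set cs \<subseteq> {Hyp, Double 0 0}" "full_dec ([Double 1 0] @ cs)" by auto
    then obtain k l where "full_dec ([Double 1 0] @ replicate k Hyp @ replicate l (Double 0 0))"
      using full_dec_two_values by blast
    then have "full_dec (replicate k Hyp @ Double 1 0 # replicate l (Double 0 0))"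
      by (rule full_dec_cong) simp
    then show ?thesis by blast
  qed
qed

section \<open>Spreading unequal parameters\<close>

text \<open>The polynomial \<open>1 + x + x^2\<close> has a root, and its value at 0 and at 1 is
  1.\<close>

lemma element_not_0_1: "\<exists>x::'k. x \<noteq> 0 \<and> x \<noteq> 1"
proof -
  have "degree [:1, 1, 1 :: 'k:] > 0" by simp
  then obtain x where "poly [:1, 1, 1:] x = (0::'k)" using alg_closed_imp_poly_has_root by blast
  then show ?thesis by (intro exI[of _ x]) auto
qed

lemma Single_sum_zero:
  assumes "full_dec (Single a # Single d # rest)" "a \<noteq> d"
  shows "full_dec (Single 0 # Single (a + d) # rest)"
  using replace_Single_Single[OF assms, of 0] unfolding add_0_left .

text \<open>An unequal pair is exchanged for 0 and its sum. The induction continues as long as the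
  parameters other than this 0 still contain two different ones.\<close>

lemma normal_form_Singles_unequal:
  assumes "full_dec (map Single ss @ rest)" "x \<in> set ss" "y \<in> set ss" "x \<noteq> y"
  shows "\<exists>s. (length ss = 2 \<longrightarrow> s \<noteq> 1) \<and> length ss \<ge> 2 \<and>
    full_dec (replicate (length ss - 2) (Single 0) @ Single 1 # Single s # rest)"
  using assms
proof (induction "length ss" arbitrary: ss rest x y rule: less_induct)
  case less
  have "mset ss = add_mset x (mset ss - {#x#})" using less.prems(2) by simp
  moreover have "y \<in># mset ss - {#x#}" using less.prems(3,4) by (simp add: in_diff_count)
  ultimately have "mset ss = add_mset x (add_mset y (mset ss - {#x#} - {#y#}))"
    by (metis insert_DiffM)
  then obtain rs where rs: "mset ss = mset (x # y # rs)" by (metis ex_mset mset.simps(2))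
  then have len: "length ss = length rs + 2" by (metis add_2_eq_Suc' length_Cons mset_eq_length)
  have fd: "full_dec (Single x # Single y # map Single rs @ rest)"
    by (rule full_dec_cong[OF less.prems(1)]) (use rs in \<open>simp add: mset_map\<close>)
  \<comment> \<open>The new \<open>Single 0\<close> is put into \<open>rest\<close>, which is
    arbitrary in the induction. As \<open>rs\<close> is nonempty, \<open>ss\<close> has length at
    least 3 and the condition for length 2 is vacuous.\<close>
  have step: ?case if "full_dec (Single 0 # map Single us @ rest)" "u \<in> set us" "v \<in> set us"
    "u \<noteq> v" "length us = length rs + 1" "rs \<noteq> []" for us u v
  proof -
    have "full_dec (map Single us @ Single 0 # rest)" by (rule full_dec_cong[OF that(1)]) simp
    from less.hyps[OF _ this that(2-4)] that(5) len obtain s where s: "length us \<ge> 2"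
      "full_dec (replicate (length us - 2) (Single 0) @ Single 1 # Single s # Single 0 # rest)"
      by auto
    have "length ss - 2 = Suc (length us - 2)" using len that(5) s(1) by simp
    then have "full_dec (replicate (length ss - 2) (Single 0) @ Single 1 # Single s # rest)"
      by (intro full_dec_cong[OF s(2)]) simp
    then show ?thesis using len that(6) by auto
  qed
  show ?case
  proof (cases rs)
    case Nil
    then have "full_dec (Single 1 # Single (1 + x + y) # rest)"
      using replace_Single_Single[OF fd less.prems(4), of 1] by simp
    moreover have "1 + x + y \<noteq> 1"
      using less.prems(4) by (simp add: add.assoc)
    ultimately show ?thesis using len Nil by (intro exI[of _ "1 + x + y"]) auto
  next
    case (Cons r rs')
    define d where "d = x + y"
    have d: "d \<noteq> 0" using less.prems(4) by (simp add: d_def)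
    have fd0: "full_dec (Single 0 # Single d # map Single rs @ rest)"
      using Single_sum_zero[OF fd less.prems(4)] by (simp add: d_def)
    show ?thesis
    proof (cases "\<forall>u\<in>set rs. u = d")
      case False
      then obtain u where "u \<in> set rs" "u \<noteq> d" by blast
      then show ?thesis using step[of "d # rs" u d] fd0 Cons by auto
    next
      case True
      then have rs': "r = d" "\<forall>u\<in>set rs'. u = d" using Cons by auto
      \<comment> \<open>The parameters \<open>0, d, d\<close> become \<open>z, z + d, d\<close>; the
        last two differ as \<open>z \<noteq> 0\<close> and are exchanged for
        \<open>0, z\<close>.\<close>
      have ex: "full_dec (Single 0 # Single z # Single z # map Single rs' @ rest)" if "z \<noteq> 0" for z
      proof -
        have "full_dec (Single z # Single (z + d) # Single d # map Single rs' @ rest)"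
          using replace_Single_Single[OF fd0, of z] d Cons rs' by auto
        then have "full_dec (Single (z + d) # Single d # Single z # map Single rs' @ rest)"
          by (rule full_dec_cong) simp
        from Single_sum_zero[OF this] that
        have "full_dec (Single 0 # Single (z + d + d) # Single z # map Single rs' @ rest)"
          by (metis add_cancel_right_left)
        moreover have "z + d + d = z" by (simp add: add.assoc)
        ultimately show ?thesis by simp
      qed
      show ?thesis
      proof (cases rs')
        case Nil
        \<comment> \<open>With three parameters the final value 1 is allowed, so
          \<open>0, 1, 1\<close> is already normal.\<close>
        have "full_dec (Single 0 # Single 1 # Single 1 # rest)" using ex[of 1] Nil by simp
        then show ?thesis using len Cons Nil by (auto intro!: exI[of _ 1])
      next
        case (Cons r' rs'')
        \<comment> \<open>Here the parameters are \<open>0, d, \<dots>, d\<close>, and splitting off the 0 would leave equal ones; so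
          \<open>0, d, d\<close> is first replaced by \<open>0, z, z\<close>.\<close>
        obtain x' :: 'k where x': "x' \<noteq> 0" "x' \<noteq> 1" using element_not_0_1 by blast
        define z where "z = (if d = 1 then x' else 1)"
        have z: "z \<noteq> 0" "z \<noteq> d" using x' by (auto simp: z_def)
        show ?thesis
        proof (rule step[of "z # z # rs'" z d])
          show "full_dec (Single 0 # map Single (z # z # rs') @ rest)" using ex[OF z(1)] by simp
          show "z \<in> set (z # z # rs')" "d \<in> set (z # z # rs')" using rs' Cons by auto
        qed (use z \<open>rs = r # rs'\<close> in simp_all)
      qed
    qed
  qed
qed

text \<open>One \<open>Single\<close> dissolves all \<open>Double\<close> atoms. What remains
  besides hyperbolic planes is a list of parameters, and the two outcomes are that these are all
  equal or not.\<close>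

lemma normal_form_Single:
  assumes "full_dec as" "Unit \<notin> set as" "Single a \<in> set as"
  shows "\<exists>k l s. full_dec (replicate k Hyp @ replicate (Suc l) (Single s)) \<or>
    ((l = 0 \<longrightarrow> s \<noteq> 1) \<and>
      full_dec (replicate k Hyp @ replicate l (Single 0) @ [Single 1, Single s]))"
proof -
  obtain l r where as: "as = l @ Single a # r" using assms(3) by (meson split_list)
  have "full_dec ([Single a] @ l @ r)" by (rule full_dec_cong[OF assms(1)]) (simp add: as)
  then have "\<exists>h'\<in>range (\<lambda>s. [Single s]). \<exists>bs. set bs \<subseteq> insert Hyp (range Single) \<and> full_dec (h' @ bs)"
  proof (rule full_dec_eliminate[where Q = "- {Unit}" and h = "[Single a]", rotated 3])
    fix h a rest
    assume *: "h \<in> range (\<lambda>s. [Single s])" "a \<in> - {Unit}" "full_dec (h @ a # rest)"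
    then obtain s where h: "h = [Single s]" by auto
    from *(2) consider "a \<in> insert Hyp (range Single)" | i j where "a = Double i j"
      by (cases a) auto
    then show "\<exists>h'\<in>range (\<lambda>s. [Single s]). \<exists>cs. set cs \<subseteq> insert Hyp (range Single) \<and>
      full_dec (h' @ cs @ rest)"
    proof cases
      case 1
      with * h show ?thesis by (intro bexI[of _ h] exI[of _ "[a]"]) auto
    next
      case 2
      with * h have "full_dec (Single s # Double i j # rest)" by simp
      \<comment> \<open>The parameter of the head changes from \<open>s\<close> to
        \<open>s + i\<close>, hence heads with arbitrary parameters.\<close>
      from replace_Single_Double[OF this] show ?thesis
        by (intro bexI[of _ "[Single (s + i)]"] exI[of _ "[Single (s + j), Single (s + i + j)]"]) auto
    qed
  qed (use assms(2) as in auto)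
  then obtain s bs where bs: "set bs \<subseteq> insert Hyp (range Single)" "full_dec (Single s # bs)" by auto
  have "\<exists>k ss. mset bs = mset (map Single ss @ replicate k Hyp)" using bs(1)
  proof (induction bs)
    case Nil
    then show ?case by simp
  next
    case (Cons c bs)
    then obtain k ss where *: "mset bs = mset (map Single ss @ replicate k Hyp)" by auto
    from Cons.prems consider "c = Hyp" | s where "c = Single s" by auto
    then show ?case
    proof cases
      case 1
      then show ?thesis using * by (intro exI[of _ "Suc k"] exI[of _ ss]) auto
    next
      case 2
      then show ?thesis using * by (intro exI[of _ k] exI[of _ "s # ss"]) auto
    qed
  qed
  then obtain k ss where *: "mset bs = mset (map Single ss @ replicate k Hyp)" by auto
  have fd: "full_dec (map Single (s # ss) @ replicate k Hyp)"
    by (rule full_dec_cong[OF bs(2)]) (simp add: *)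
  show ?thesis
  proof (cases "\<forall>u\<in>set ss. u = s")
    case True
    then have "map Single (s # ss) = replicate (Suc (length ss)) (Single s)"
      by (simp add: map_replicate_const[symmetric])
    with fd have "full_dec (replicate (Suc (length ss)) (Single s) @ replicate k Hyp)" by simp
    then have "full_dec (replicate k Hyp @ replicate (Suc (length ss)) (Single s))"
      by (rule full_dec_cong) simp
    then show ?thesis by blast
  next
    case False
    then obtain u where "u \<in> set (s # ss)" "u \<noteq> s" by auto
    from normal_form_Singles_unequal[OF fd this(1) _ this(2)] obtain z where z:
      "length (s # ss) = 2 \<longrightarrow> z \<noteq> 1" "length (s # ss) \<ge> 2"
      "full_dec (replicate (length (s # ss) - 2) (Single 0) @ Single 1 # Single z # replicate k Hyp)"
      by auto
    have "full_dec (replicate k Hyp @ replicate (length (s # ss) - 2) (Single 0) @ [Single 1, Single z])"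
      by (rule full_dec_cong[OF z(3)]) simp
    moreover have "length (s # ss) - 2 = 0 \<longrightarrow> z \<noteq> 1" using z(1,2) by auto
    ultimately show ?thesis
      by (intro exI[of _ k] exI[of _ "length (s # ss) - 2"] exI[of _ z] disjI2 conjI)
  qed
qed

end

section \<open>Decompositions as matrix forms\<close>

text \<open>Both an orthogonal sum and a successor number of copies unfold to this shape, so one
  gluing lemma serves both.\<close>

definition four_block_form :: "'k::field matform \<Rightarrow> 'k matform \<Rightarrow> 'k matform" where
  "four_block_form F G =
     (four_block_mat (fst F) (0\<^sub>m (dim_row (fst F)) (dim_col (fst G)))
        (0\<^sub>m (dim_row (fst G)) (dim_col (fst F))) (fst G),
      four_block_mat (snd F) (0\<^sub>m (dim_row (snd F)) (dim_col (snd G)))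
        (0\<^sub>m (dim_row (snd G)) (dim_col (snd F))) (snd G))"

lemma form_sum_eq: "F \<boxplus> G = four_block_form F G"
proof -
  have *: "diag_block_mat [A, B] =
      four_block_mat A (0\<^sub>m (dim_row A) (dim_col B)) (0\<^sub>m (dim_row B) (dim_col A)) B"
    for A B :: "'a mat"
    unfolding diag_block_mat.simps(2)[of A] Let_def diag_block_mat_singleton ..
  show ?thesis unfolding form_sum_def four_block_form_def * ..
qed

lemma form_copies_0: "0 \<boxdot> F = (0\<^sub>m 0 0, 0\<^sub>m 0 0)"
  by (simp add: form_copies_def)

lemma form_copies_Suc: "Suc k \<boxdot> F = four_block_form F (k \<boxdot> F)"
  by (simp add: form_copies_def four_block_form_def Let_def)

lemma diag_block_mat_replicate_zero:
  "diag_block_mat (replicate k (0\<^sub>m r c)) = 0\<^sub>m (k * r) (k * c)"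
proof (induction k)
  case (Suc k)
  show ?case by (rule eq_matI) (auto simp: Suc Let_def)
qed simp

lemma alpha1_eq_copies: "alpha1 k = k \<boxdot> (0\<^sub>m 1 1, 1\<^sub>m 1)"
proof -
  have "diag_block_mat (replicate k (1\<^sub>m 1)) = (1\<^sub>m k :: 'a mat)"
  proof (induction k)
    case (Suc k)
    show ?case by (rule eq_matI) (auto simp: Suc[unfolded One_nat_def] Let_def)
  qed auto
  then show ?thesis
    unfolding alpha1_def form_copies_def fst_conv snd_conv diag_block_mat_replicate_zero
    by (simp only: mult_1_right)
qed

lemma alpha2_eq_copies:
  "alpha2 (2 * k) = k \<boxdot> (0\<^sub>m 2 2, mat_of_rows_list 2 [[0, 1], [1, 0]])"
  by (simp add: alpha2_def form_copies_def diag_block_mat_replicate_zero mult.commute)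

lemma sum_lessThan_add:
  fixes f :: "nat \<Rightarrow> 'a::comm_monoid_add"
  shows "(\<Sum>i<m + n. f i) = (\<Sum>i<m. f i) + (\<Sum>i<n. f (m + i))"
  by (induction n) (simp_all add: add.assoc)

lemma all_less_2: "(\<forall>i<2::nat. P i) \<longleftrightarrow> P 0 \<and> P 1"
  by (auto simp: less_2_cases_iff)

lemma all_less_4: "(\<forall>i<4::nat. P i) \<longleftrightarrow> P 0 \<and> P 1 \<and> P 2 \<and> P 3"
  by (auto simp: numeral_eq_Suc less_Suc_eq)

lemma sum_less_2: "(\<Sum>i<2. f i) = f 0 + (f (1::nat) :: 'a::comm_monoid_add)"
  by (simp add: numeral_eq_Suc)

lemma sum_less_4: "(\<Sum>i<4. f i) = f 0 + f 1 + f 2 + (f (3::nat) :: 'a::comm_monoid_add)"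
  by (simp add: numeral_eq_Suc)

lemma mat_of_rows_list_carrier: "length rs = n \<Longrightarrow> mat_of_rows_list m rs \<in> carrier_mat n m"
  by (simp add: mat_of_rows_list_def)

section \<open>Dimension and rank as invariants\<close>

primrec atom_size :: "'k atom \<Rightarrow> nat" where
  "atom_size Unit = 1" | "atom_size Hyp = 2" | "atom_size (Single s) = 2"
| "atom_size (Double i j) = 4"

primrec atom_rank :: "'k atom \<Rightarrow> nat" where
  "atom_rank Unit = 0" | "atom_rank Hyp = 0" | "atom_rank (Single s) = 1"
| "atom_rank (Double i j) = 2"

context nilpotent_form
begin

lemma length_dec: "dec as xs \<Longrightarrow> length xs = sum_list (map atom_size as)"
proof (induction as arbitrary: xs)
  case (Cons a as)
  then show ?case by (cases a) auto
qed simp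

text \<open>Sorting the basis by its behaviour under \<open>t\<close> exhibits a Jordan basis:
  vectors killed by \<open>t\<close> from \<open>Unit\<close> and \<open>Hyp\<close>, chains
  \<open>w, t w\<close> from the other atoms.\<close>

lemma dec_jordan:
  assumes "dec as xs"
  shows "\<exists>ls ws. mset xs = mset (ls @ ws @ map t ws) \<and> length ws = sum_list (map atom_rank as) \<and>
    (\<forall>l\<in>set ls. t l = 0)"
  using assms
proof (induction as arbitrary: xs)
  case (Cons a as)
  then obtain zs ys where *: "xs = zs @ ys" "atom_basis a zs" "dec as ys" by auto
  from Cons.IH[OF *(3)] obtain ls ws where IH: "mset ys = mset (ls @ ws @ map t ws)"
    "length ws = sum_list (map atom_rank as)" "\<forall>l\<in>set ls. t l = 0" by blast
  have "\<exists>ls' ws'. mset zs = mset (ls' @ ws' @ map t ws') \<and> length ws' = atom_rank a \<and>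
    (\<forall>l\<in>set ls'. t l = 0)"
  proof (cases a)
    case Unit
    with *(2) show ?thesis by (intro exI[of _ zs] exI[of _ "[]"]) auto
  next
    case Hyp
    with *(2) show ?thesis by (intro exI[of _ zs] exI[of _ "[]"]) auto
  next
    case (Single s)
    with *(2) obtain w where "zs = [w, t w]" by auto
    with Single show ?thesis by (intro exI[of _ "[]"] exI[of _ "[w]"]) auto
  next
    case (Double i j)
    with *(2) obtain u v where "zs = [u, t u, v, t v]" by auto
    with Double show ?thesis by (intro exI[of _ "[]"] exI[of _ "[u, v]"]) auto
  qed
  then obtain ls' ws' where "mset zs = mset (ls' @ ws' @ map t ws')" "length ws' = atom_rank a"
    "\<forall>l\<in>set ls'. t l = 0" by blast
  with IH *(1) show ?case by (intro exI[of _ "ls' @ ls"] exI[of _ "ws' @ ws"]) auto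
qed auto

text \<open>The images of \<open>ws\<close> span the image of \<open>t\<close> and are independent
  as part of a basis. It serves both for decompositions and for the monomial basis of the standard
  object.\<close>

lemma dim_image_t:
  assumes "distinct (ls @ ws @ map t ws)" "independent (set (ls @ ws @ map t ws))"
    and "V \<subseteq> span (set (ls @ ws @ map t ws))" "set ws \<subseteq> V" "\<forall>l\<in>set ls. t l = 0"
  shows "dim (t ` V) = length ws"
proof (rule dim_unique)
  show "set (map t ws) \<subseteq> t ` V" using assms(4) by auto
  show "independent (set (map t ws))" by (rule independent_mono[OF assms(2)]) auto
  have "t v \<in> span (t ` set ws)" if "v \<in> span (set (ls @ ws @ map t ws))" for v
    using that
  proof (induction rule: span_induct_alt)
    case base
    then show ?case by (simp add: t_zero span_zero)
  next
    case (step c x y)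
    then have "t x \<in> insert 0 (t ` set ws)" using assms(5) by (auto simp: t_t)
    with step show ?case
      by (auto simp: bilinear span_zero intro!: span_add span_scale intro: span_base)
  qed
  then show "t ` V \<subseteq> span (set (map t ws))" using assms(3) by auto
  show "card (set (map t ws)) = length ws" 
    using distinct_card[of "map t ws"] assms(1) by simp
qed

lemma full_dec_span:
  assumes "dec as xs" "set xs \<subseteq> V" "length xs = dim V"
  shows "V \<subseteq> span (set xs)"
proof
  fix v assume v: "v \<in> V"
  show "v \<in> span (set xs)"
  proof (rule ccontr)
    assume *: "v \<notin> span (set xs)"
    note um = unimodular_dec[OF assms(1)]
    have "independent (insert v (set xs))"
      using * unimodular_independent[OF um] by (rule independent_insertI)
    moreover have "v \<notin> set xs" using * span_base by blast
    then have "card (insert v (set xs)) = Suc (dim V)"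
      using unimodular_distinct[OF um] assms(3) by (simp add: distinct_card)
    moreover obtain B where B: "B \<subseteq> V" "independent B" "V \<subseteq> span B" "card B = dim V"
      using basis_exists by blast
    moreover obtain S where S: "finite S" "V \<subseteq> span S" using finite_dim by blast
    then have "finite B" using independent_span_bound[OF S(1) B(2)] B(1) by auto
    ultimately show False
      using independent_span_bound[of B "insert v (set xs)"] v assms(2) by auto
  qed
qed

text \<open>The right-hand sides do not depend on the decomposition, so the exchanges never have to
  track m and n.\<close>

lemma full_dec_rank:
  assumes "full_dec as"
  shows "sum_list (map atom_rank as) = dim (t ` V)" "sum_list (map atom_size as) = dim V"
proof -
  obtain xs where xs: "dec as xs" "set xs \<subseteq> V" "length xs = dim V"
    using assms unfolding full_dec_def by blast
  show "sum_list (map atom_size as) = dim V" using length_dec[OF xs(1)] xs(3) by simp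
  obtain ls ws where *: "mset xs = mset (ls @ ws @ map t ws)"
    "length ws = sum_list (map atom_rank as)" "\<forall>l\<in>set ls. t l = 0" using dec_jordan[OF xs(1)] by blast
  note um = unimodular_dec[OF xs(1)]
  have set: "set (ls @ ws @ map t ws) = set xs" using mset_eq_setD[OF *(1)] by simp
  have "dim (t ` V) = length ws"
  proof (rule dim_image_t)
    show "distinct (ls @ ws @ map t ws)"
      using unimodular_distinct[OF um] mset_eq_imp_distinct_iff[OF *(1)] by simp
    show "independent (set (ls @ ws @ map t ws))"
      unfolding set by (rule unimodular_independent[OF um])
    show "V \<subseteq> span (set (ls @ ws @ map t ws))" unfolding set by (rule full_dec_span[OF xs])
    show "set ws \<subseteq> V" using set xs(2) by auto
  qed (rule *(3))
  with *(2) show "sum_list (map atom_rank as) = dim (t ` V)" by simp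
qed

section \<open>Matrices of \<open>t\<close> and \<open>b\<close> in a decomposed basis\<close>

definition comb :: "'a list \<Rightarrow> 'k vec \<Rightarrow> 'a" where
  "comb xs c = (\<Sum>j<length xs. (c $ j) *s (xs ! j))"

text \<open>Column \<open>j\<close> of the first matrix holds the coordinates of
  \<open>t (xs ! j)\<close>, in accordance with the action on column vectors.\<close>

definition realizes :: "'k matform \<Rightarrow> 'a list \<Rightarrow> bool" where
  "realizes F xs \<longleftrightarrow> fst F \<in> carrier_mat (length xs) (length xs) \<and>
     snd F \<in> carrier_mat (length xs) (length xs) \<and>
     (\<forall>j<length xs. t (xs ! j) = (\<Sum>i<length xs. (fst F $$ (i, j)) *s (xs ! i))) \<and>
     (\<forall>i<length xs. \<forall>j<length xs. b (xs ! i) (xs ! j) = snd F $$ (i, j))"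

lemma realizes_four_block:
  assumes F: "realizes F xs" and G: "realizes G ys" and o: "orth xs ys"
  shows "realizes (four_block_form F G) (xs @ ys)"
proof -
  let ?m = "length xs" and ?n = "length ys" and ?H = "four_block_form F G"
  have dims: "fst F \<in> carrier_mat ?m ?m" "snd F \<in> carrier_mat ?m ?m"
    "fst G \<in> carrier_mat ?n ?n" "snd G \<in> carrier_mat ?n ?n"
    using F G unfolding realizes_def by blast+
  have tF: "t (xs ! j) = (\<Sum>i<?m. (fst F $$ (i, j)) *s (xs ! i))" if "j < ?m" for j
    using F that unfolding realizes_def by blast
  have tG: "t (ys ! j) = (\<Sum>i<?n. (fst G $$ (i, j)) *s (ys ! i))" if "j < ?n" for j
    using G that unfolding realizes_def by blast
  have bF: "b (xs ! i) (xs ! j) = snd F $$ (i, j)" if "i < ?m" "j < ?m" for i j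
    using F that unfolding realizes_def by blast
  have bG: "b (ys ! i) (ys ! j) = snd G $$ (i, j)" if "i < ?n" "j < ?n" for i j
    using G that unfolding realizes_def by blast
  have b0: "b (xs ! i) (ys ! j) = 0" "b (ys ! j) (xs ! i) = 0" if "i < ?m" "j < ?n" for i j
    using o that b_sym[of "ys ! j" "xs ! i"] by (simp_all add: orth_def)
  have T: "fst ?H $$ (i, j) = (if i < ?m then if j < ?m then fst F $$ (i, j) else 0
      else if j < ?m then 0 else fst G $$ (i - ?m, j - ?m))" if "i < ?m + ?n" "j < ?m + ?n" for i j
    using that dims by (auto simp: four_block_form_def)
  have B: "snd ?H $$ (i, j) = (if i < ?m then if j < ?m then snd F $$ (i, j) else 0
      else if j < ?m then 0 else snd G $$ (i - ?m, j - ?m))" if "i < ?m + ?n" "j < ?m + ?n" for i j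
    using that dims by (auto simp: four_block_form_def)
  have act: "t ((xs @ ys) ! j) = (\<Sum>i<?m + ?n. (fst ?H $$ (i, j)) *s ((xs @ ys) ! i))"
    if j: "j < ?m + ?n" for j
  proof (cases "j < ?m")
    case True
    have "(\<Sum>i<?m. (fst ?H $$ (i, j)) *s ((xs @ ys) ! i)) = t (xs ! j)"
      unfolding tF[OF True] using T True by (intro sum.cong) (auto simp: nth_append)
    moreover have "(\<Sum>i<?n. (fst ?H $$ (?m + i, j)) *s ((xs @ ys) ! (?m + i))) = 0"
      using T True by (intro sum.neutral) auto
    ultimately show ?thesis using True by (simp only: sum_lessThan_add nth_append if_True add_0_right)
  next
    case False
    then have j': "j - ?m < ?n" using j by simp
    have "(\<Sum>i<?m. (fst ?H $$ (i, j)) *s ((xs @ ys) ! i)) = 0"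
      using T False j by (intro sum.neutral) auto
    moreover have "(\<Sum>i<?n. (fst ?H $$ (?m + i, j)) *s ((xs @ ys) ! (?m + i))) = t (ys ! (j - ?m))"
      unfolding tG[OF j'] using T False j by (intro sum.cong) auto
    ultimately show ?thesis using False by (simp only: sum_lessThan_add nth_append if_False add_0_left)
  qed
  have gram: "b ((xs @ ys) ! i) ((xs @ ys) ! j) = snd ?H $$ (i, j)"
    if "i < ?m + ?n" "j < ?m + ?n" for i j
    unfolding B[OF that] nth_append using that by (simp add: bF bG b0)
  have "fst ?H \<in> carrier_mat (?m + ?n) (?m + ?n)" "snd ?H \<in> carrier_mat (?m + ?n) (?m + ?n)"
    unfolding four_block_form_def fst_conv snd_conv
    by (rule four_block_carrier_mat[OF dims(1,3)] four_block_carrier_mat[OF dims(2,4)])+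
  then show ?thesis unfolding realizes_def length_append by (intro conjI allI impI act gram)
qed

lemma realizes_sum:
  assumes "dec (as @ bs) xs" "\<And>ys. dec as ys \<Longrightarrow> realizes F ys"
    "\<And>ys. dec bs ys \<Longrightarrow> realizes G ys"
  shows "realizes (F \<boxplus> G) xs"
proof -
  obtain ys zs where "xs = ys @ zs" "dec as ys" "dec bs zs" "orth ys zs"
    using assms(1) unfolding dec_append by blast
  then show ?thesis using realizes_four_block assms(2,3) unfolding form_sum_eq by metis
qed

lemma realizes_copies:
  assumes "\<And>ys. atom_basis a ys \<Longrightarrow> realizes F ys" and "dec (replicate k a) xs"
  shows "realizes (k \<boxdot> F) xs"
  using assms(2)
proof (induction k arbitrary: xs)
  case 0
  then show ?case by (simp add: form_copies_0 realizes_def)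
next
  case (Suc k)
  then obtain ys zs where *: "xs = ys @ zs" "atom_basis a ys" "dec (replicate k a) zs" "orth ys zs"
    by auto
  show ?case unfolding form_copies_Suc *(1)
    by (rule realizes_four_block[OF assms(1)[OF *(2)] Suc.IH[OF *(3)] *(4)])
qed

lemma realizes_Unit:
  assumes "atom_basis Unit xs"
  shows "realizes (0\<^sub>m 1 1, 1\<^sub>m 1) xs"
proof -
  obtain u where *: "xs = [u]" "t u = 0" "b u u = 1" using assms by auto
  have len: "length xs = 1" using * by simp
  have act: "\<forall>j<1. t (xs ! j) = (\<Sum>i<1. (0\<^sub>m 1 1 $$ (i, j)) *s (xs ! i))"
    unfolding *(1) by (simp add: *(2))
  have gram: "\<forall>i<1. \<forall>j<1. b (xs ! i) (xs ! j) = 1\<^sub>m 1 $$ (i, j)"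
    unfolding *(1) by (simp add: *(3))
  show ?thesis unfolding realizes_def len fst_conv snd_conv
    by (intro conjI one_carrier_mat act gram zero_carrier_mat)
qed

lemma realizes_Hyp:
  assumes "atom_basis Hyp xs"
  shows "realizes (0\<^sub>m 2 2, mat_of_rows_list 2 [[0, 1], [1, 0]]) xs"
proof -
  obtain u v where *: "xs = [u, v]" "t u = 0" "t v = 0" "b u u = 0" "b v v = 0" "b u v = 1"
    using assms by auto
  have **: "b v u = 1" using * b_sym by metis
  have len: "length xs = 2" using * by simp
  have act: "\<forall>j<2. t (xs ! j) = (\<Sum>i<2. (0\<^sub>m 2 2 $$ (i, j)) *s (xs ! i))"
    unfolding all_less_2 sum_less_2 *(1) by (simp add: *(2,3))
  have gram: "\<forall>i<2. \<forall>j<2. b (xs ! i) (xs ! j) = mat_of_rows_list 2 [[0, 1], [1, 0]] $$ (i, j)"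
    unfolding all_less_2 mat_of_rows_list_def *(1) by (simp add: *(4-) **)
  show ?thesis unfolding realizes_def len fst_conv snd_conv
    by (intro conjI mat_of_rows_list_carrier act gram zero_carrier_mat) simp
qed

lemma realizes_Single:
  assumes "atom_basis (Single s) xs"
  shows "realizes (beta_P (s\<^sup>2)) xs"
proof -
  obtain w where *: "xs = [w, t w]" "b w w = s\<^sup>2" "b (t w) w = 1" using assms by auto
  have len: "length xs = 2" using * by simp
  have act: "\<forall>j<2. t (xs ! j) =
      (\<Sum>i<2. (mat_of_rows_list 2 [[0, 0], [1, 0]] $$ (i, j)) *s (xs ! i))"
    unfolding all_less_2 sum_less_2 mat_of_rows_list_def *(1) by (simp add: t_t)
  have gram: "\<forall>i<2. \<forall>j<2. b (xs ! i) (xs ! j) =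
      mat_of_rows_list 2 [[s\<^sup>2, 1], [1, 0]] $$ (i, j)"
    unfolding all_less_2 mat_of_rows_list_def *(1) by (simp add: *(2-) b_t t_t b_zero)
  show ?thesis unfolding realizes_def len beta_P_def P_act_def fst_conv snd_conv
    by (intro conjI mat_of_rows_list_carrier act gram) simp_all
qed

lemma realizes_Double:
  assumes "atom_basis (Double i 0) xs"
  shows "realizes (beta_2P (i\<^sup>2)) xs"
proof -
  obtain u v where *: "xs = [u, t u, v, t v]" "b u u = i\<^sup>2" "b v v = 0" "b u v = 0"
    "b (t u) u = 0" "b (t v) v = 0" "b (t u) v = 1" using assms by auto
  have **: "b v u = 0" "b (t v) u = 1" using * b_sym b_t by metis+
  have len: "length xs = 4" using * by simp
  have P: "diag_block_mat [P_act, P_act] =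
      (mat_of_rows_list 4 [[0,0,0,0],[1,0,0,0],[0,0,0,0],[0,0,1,0]] :: 'k mat)"
    by (rule eq_matI) (auto simp: P_act_def mat_of_rows_list_def Let_def less_Suc_eq numeral_eq_Suc)
  have act: "\<forall>j<4. t (xs ! j) =
      (\<Sum>i<4. (mat_of_rows_list 4 [[0,0,0,0],[1,0,0,0],[0,0,0,0],[0,0,1,0]] $$ (i, j)) *s (xs ! i))"
    unfolding all_less_4 sum_less_4 mat_of_rows_list_def *(1) by (simp add: t_t)
  have gram: "\<forall>k<4. \<forall>j<4. b (xs ! k) (xs ! j) =
      mat_of_rows_list 4 [[i\<^sup>2,0,0,1],[0,0,1,0],[0,1,0,0],[1,0,0,0]] $$ (k, j)"
    unfolding all_less_4 mat_of_rows_list_def *(1) by (simp add: *(2-) ** b_t t_t b_zero)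
  show ?thesis unfolding realizes_def len beta_2P_def P fst_conv snd_conv
    by (intro conjI mat_of_rows_list_carrier act gram) simp_all
qed

lemma comb_in_V: "set xs \<subseteq> V \<Longrightarrow> comb xs c \<in> V"
  unfolding comb_def by (intro subspace_sum[OF subspace_V] V_scale) auto

lemma comb_add:
  "u \<in> carrier_vec (length xs) \<Longrightarrow> v \<in> carrier_vec (length xs) \<Longrightarrow>
    comb xs (u + v) = comb xs u + comb xs v"
  by (auto simp: comb_def scale_left_distrib sum.distrib)

lemma comb_smult: "v \<in> carrier_vec (length xs) \<Longrightarrow> comb xs (c \<cdot>\<^sub>v v) = c *s comb xs v"
  by (auto simp: comb_def scale_sum_right)

lemma comb_t:
  assumes "realizes F xs" "v \<in> carrier_vec (length xs)"
  shows "comb xs (fst F *\<^sub>v v) = t (comb xs v)"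
proof -
  let ?n = "length xs"
  have "comb xs (fst F *\<^sub>v v) = (\<Sum>i<?n. (\<Sum>j<?n. fst F $$ (i, j) * v $ j) *s (xs ! i))"
    unfolding comb_def using assms
    by (intro sum.cong) (auto simp: realizes_def scalar_prod_def lessThan_atLeast0)
  also have "\<dots> = (\<Sum>j<?n. \<Sum>i<?n. (fst F $$ (i, j) * v $ j) *s (xs ! i))"
    by (subst sum.swap) (simp add: scale_sum_left)
  also have "\<dots> = (\<Sum>j<?n. v $ j *s t (xs ! j))"
    using assms by (intro sum.cong) (auto simp: realizes_def scale_sum_right mult.commute)
  also have "\<dots> = t (comb xs v)" by (simp add: comb_def t_sum t_scale)
  finally show ?thesis .
qed

lemma comb_b:
  assumes "realizes F xs" "u \<in> carrier_vec (length xs)" "v \<in> carrier_vec (length xs)"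
  shows "b (comb xs u) (comb xs v) = gram_form (snd F) u v"
proof -
  let ?n = "length xs"
  have "b (comb xs u) (comb xs v) = (\<Sum>i<?n. \<Sum>j<?n. u $ i * (v $ j * b (xs ! i) (xs ! j)))"
    unfolding comb_def b_sum b_sum_right b_scale b_scale_right
    by (subst sum.swap) (simp add: sum_distrib_left mult.left_commute)
  also have "\<dots> = (\<Sum>i<?n. u $ i * (\<Sum>j<?n. snd F $$ (i, j) * v $ j))"
    using assms(1) by (auto simp: realizes_def sum_distrib_left mult.commute intro!: sum.cong)
  also have "\<dots> = gram_form (snd F) u v"
    using assms by (auto simp: gram_form_def realizes_def scalar_prod_def lessThan_atLeast0 intro!: sum.cong)
  finally show ?thesis .
qed

lemma comb_bij:
  assumes "dec as xs" "set xs \<subseteq> V" "length xs = dim V"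
  shows "bij_betw (comb xs) (carrier_vec (dim V)) V"
proof -
  note um = unimodular_dec[OF assms(1)]
  have "inj_on (comb xs) (carrier_vec (dim V))"
  proof (rule inj_onI)
    fix u v assume u: "u \<in> carrier_vec (dim V)" and v: "v \<in> carrier_vec (dim V)"
      and eq: "comb xs u = comb xs v"
    show "u = v"
    proof (rule eq_vecI)
      fix i assume i: "i < dim_vec v"
      \<comment> \<open>\<open>z\<close> is dual to \<open>xs ! i\<close>, so pairing with it
        recovers the coordinate \<open>i\<close>.\<close>
      obtain z where z: "\<forall>j<length xs. b z (xs ! j) = (if j = i then 1 else 0)"
        using um unfolding unimodular_def
        by (drule_tac spec[where x="\<lambda>j. if j = i then 1 else 0"]) blast
      have "b z (comb xs w) = w $ i" for w
      proof -
        have "b z (comb xs w) = (\<Sum>j<length xs. if j = i then w $ j else 0)"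
          unfolding comb_def b_sum_right b_scale_right using z by (intro sum.cong) auto
        also have "\<dots> = w $ i" using i v assms(3) by auto
        finally show ?thesis .
      qed
      with eq show "u $ i = v $ i" by metis
    qed (use u v in auto)
  qed
  moreover have "comb xs ` carrier_vec (dim V) = V"
  proof
    show "comb xs ` carrier_vec (dim V) \<subseteq> V" using comb_in_V[OF assms(2)] by auto
    show "V \<subseteq> comb xs ` carrier_vec (dim V)"
    proof
      fix v assume "v \<in> V"
      then have "v \<in> span (set xs)" using full_dec_span[OF assms] by auto
      then obtain g where "v = (\<Sum>x\<in>set xs. g x *s x)" by (auto simp: span_finite)
      also have "\<dots> = (\<Sum>j<length xs. g (xs ! j) *s (xs ! j))"
        using bij_betw_nth[OF unimodular_distinct[OF um] refl refl]
        by (rule sum.reindex_bij_betw[symmetric])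
      also have "\<dots> = comb xs (vec (dim V) (\<lambda>j. g (xs ! j)))"
        unfolding comb_def using assms(3) by (intro sum.cong) auto
      finally show "v \<in> comb xs ` carrier_vec (dim V)" by auto
    qed
  qed
  ultimately show ?thesis by (simp add: bij_betw_def)
qed

text \<open>\<open>L\<close> identifies \<open>V\<close> with the given object, and \<open>L\<close>
  after \<open>comb xs\<close> is the required isomorphism from the matrix object.\<close>

lemma equivalent_to_if_realizes:
  fixes U :: "('k, 'v) tmodule"
  assumes "full_dec as" and F: "\<And>xs. dec as xs \<Longrightarrow> realizes F xs"
    and L: "bij_betw L V (carrier U)"
    and L_add: "\<And>u v. u \<in> V \<Longrightarrow> v \<in> V \<Longrightarrow> L (u + v) = L u \<oplus>\<^bsub>U\<^esub> L v"
    and L_scale: "\<And>c u. u \<in> V \<Longrightarrow> L (c *s u) = c \<odot>\<^bsub>U\<^esub> L u"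
    and L_t: "\<And>u. u \<in> V \<Longrightarrow> L (t u) = act U (L u)"
    and L_b: "\<And>u v. u \<in> V \<Longrightarrow> v \<in> V \<Longrightarrow> b u v = \<beta> (L u) (L v)"
  shows "equivalent_to U \<beta> F"
proof -
  obtain xs where xs: "dec as xs" "set xs \<subseteq> V" "length xs = dim V"
    using assms(1) unfolding full_dec_def by blast
  note Fxs = F[OF xs(1)]
  have dim [simp]: "dim_row (fst F) = dim V"
    using Fxs unfolding realizes_def xs(3) by (meson carrier_matD(1))
  let ?\<phi> = "\<lambda>c. L (comb xs c)"
  have carr: "carrier (mat_object (fst F)) = carrier_vec (dim V)" by (simp add: mat_object_def)
  have bij: "bij_betw ?\<phi> (carrier_vec (dim V)) (carrier U)"
    using bij_betw_trans[OF comb_bij[OF xs] L] by (simp add: o_def)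
  have iso: "?\<phi> \<in> ver4_iso (mat_object (fst F)) U"
    unfolding ver4_iso_def ver4_hom_def LinearCombinations.module_hom_def carr
    using bij bij_betw_imp_funcset[OF bij] comb_in_V[OF xs(2)]
    by (auto simp: mat_object_def comb_add comb_smult comb_t[OF Fxs] L_add L_scale L_t xs(3))
  have gram: "\<forall>u\<in>carrier_vec (dim V). \<forall>v\<in>carrier_vec (dim V).
      gram_form (snd F) u v = \<beta> (?\<phi> u) (?\<phi> v)"
    using comb_b[OF Fxs] L_b comb_in_V[OF xs(2)] xs(3) by metis
  show ?thesis
    unfolding equivalent_to_def ver4_form_equiv_def carr by (rule bexI[OF _ iso]) (rule gram)
qed


section \<open>From normal forms to the six cases\<close>

lemma dec_single: "dec [a] xs \<longleftrightarrow> atom_basis a xs"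
  by auto

lemma realizes_Units: "dec (replicate k Unit) xs \<Longrightarrow> realizes (alpha1 k) xs"
  unfolding alpha1_eq_copies by (rule realizes_copies[OF realizes_Unit])

lemma realizes_Hyps: "dec (replicate k Hyp) xs \<Longrightarrow> realizes (alpha2 (2 * k)) xs"
  unfolding alpha2_eq_copies by (rule realizes_copies[OF realizes_Hyp])

lemma realizes_Singles: "dec (replicate k (Single s)) xs \<Longrightarrow> realizes (k \<boxdot> beta_P (s\<^sup>2)) xs"
  by (rule realizes_copies[OF realizes_Single])

lemma realizes_Doubles: "dec (replicate k (Double i 0)) xs \<Longrightarrow> realizes (k \<boxdot> beta_2P (i\<^sup>2)) xs"
  by (rule realizes_copies[OF realizes_Double])

text \<open>\<open>Q\<close> stands for equivalence with the given form, which lives on an object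
  foreign to the locale.\<close>

lemma classification:
  assumes dim_V: "dim V = m + 2 * n" and dim_tV: "dim (t ` V) = n"
    and Q: "\<And>as F. full_dec as \<Longrightarrow> (\<And>xs. dec as xs \<Longrightarrow> realizes F xs) \<Longrightarrow> Q F"
  shows
    "(m > 0 \<and> 2 dvd n \<and> Q (alpha1 m \<boxplus> (n div 2) \<boxdot> beta_2P 0)) \<or>
     (m > 0 \<and> n > 0 \<and> Q (alpha1 m \<boxplus> n \<boxdot> beta_P 0)) \<or>
     (2 dvd m \<and> 2 dvd n \<and> Q (alpha2 m \<boxplus> (n div 2) \<boxdot> beta_2P 0)) \<or>
     (2 dvd m \<and> 2 dvd n \<and> n \<ge> 2 \<and> Q (alpha2 m \<boxplus> beta_2P 1 \<boxplus> ((n - 2) div 2) \<boxdot> beta_2P 0)) \<or>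
     (\<exists>y. 2 dvd m \<and> n > 0 \<and> Q (alpha2 m \<boxplus> n \<boxdot> beta_P y)) \<or>
     (\<exists>y. 2 dvd m \<and> n \<ge> 2 \<and> (1 + y, n) \<noteq> (0, 2) \<and>
        Q (alpha2 m \<boxplus> (n - 2) \<boxdot> beta_P 0 \<boxplus> beta_P 1 \<boxplus> beta_P y))"
    (is "?A \<or> ?B \<or> ?C \<or> ?D \<or> ?E \<or> ?F")
proof -
  obtain as where as: "full_dec as" using full_dec_exists by blast
  \<comment> \<open>Comparing counts expresses m and n through the lengths of the normal form; all
    parity and positivity conditions come from here.\<close>
  have sz: "sum_list (map atom_rank bs) = n" "sum_list (map atom_size bs) = m + 2 * n"
    if "full_dec bs" for bs
    using full_dec_rank[OF that] dim_V dim_tV by simp_all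
  have A: ?A if fd: "full_dec (replicate (Suc k) Unit @ replicate l (Double 0 0))" for k l
  proof -
    have n: "n = l * 2" and m: "m = Suc k" using sz[OF fd] by (simp_all add: sum_list_replicate)
    have "Q (alpha1 (Suc k) \<boxplus> l \<boxdot> beta_2P (0\<^sup>2))"
      by (rule Q[OF fd], rule realizes_sum, assumption, rule realizes_Units, assumption,
          rule realizes_Doubles, assumption)
    then show ?thesis using n m by simp
  qed
  have B: ?B if fd: "full_dec (replicate (Suc k) Unit @ replicate (Suc l) (Single 0))" for k l
  proof -
    have n: "n = Suc l" and m: "m = Suc k" using sz[OF fd] by (simp_all add: sum_list_replicate)
    have "Q (alpha1 (Suc k) \<boxplus> Suc l \<boxdot> beta_P (0\<^sup>2))"
      by (rule Q[OF fd], rule realizes_sum, assumption, rule realizes_Units, assumption,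
          rule realizes_Singles, assumption)
    then show ?thesis using n m by simp
  qed
  have C: ?C if fd: "full_dec (replicate k Hyp @ replicate l (Double 0 0))" for k l
  proof -
    have n: "n = l * 2" and m: "m = 2 * k" using sz[OF fd] by (simp_all add: sum_list_replicate)
    have "Q (alpha2 (2 * k) \<boxplus> l \<boxdot> beta_2P (0\<^sup>2))"
      by (rule Q[OF fd], rule realizes_sum, assumption, rule realizes_Hyps, assumption,
          rule realizes_Doubles, assumption)
    then show ?thesis using n m by simp
  qed
  have D: ?D if fd: "full_dec (replicate k Hyp @ [Double 1 0] @ replicate l (Double 0 0))" for k l
  proof -
    have n: "n = l * 2 + 2" and m: "m = 2 * k" using sz[OF fd] by (simp_all add: sum_list_replicate)
    have "Q (alpha2 (2 * k) \<boxplus> beta_2P (1\<^sup>2) \<boxplus> l \<boxdot> beta_2P (0\<^sup>2))"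
      by (rule Q[OF fd], rule realizes_sum, assumption, rule realizes_Hyps, assumption,
          rule realizes_sum, assumption, rule realizes_Double, simp only: dec_single,
          rule realizes_Doubles, assumption)
    then show ?thesis using n m by simp
  qed
  have E: ?E if fd: "full_dec (replicate k Hyp @ replicate (Suc l) (Single s))" for k l s
  proof -
    have n: "n = Suc l" and m: "m = 2 * k" using sz[OF fd] by (simp_all add: sum_list_replicate)
    have "Q (alpha2 (2 * k) \<boxplus> Suc l \<boxdot> beta_P (s\<^sup>2))"
      by (rule Q[OF fd], rule realizes_sum, assumption, rule realizes_Hyps, assumption,
          rule realizes_Singles, assumption)
    then show ?thesis using n m by (intro exI[of _ "s\<^sup>2"]) simp
  qed
  have F: ?F if fd: "full_dec (replicate k Hyp @ replicate l (Single 0) @ [Single 1] @ [Single s])"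
    and s: "l = 0 \<longrightarrow> s \<noteq> 1" for k l s
  proof -
    have n: "n = l + 2" and m: "m = 2 * k" using sz[OF fd] by (simp_all add: sum_list_replicate)
    have "Q (alpha2 (2 * k) \<boxplus> l \<boxdot> beta_P (0\<^sup>2) \<boxplus> beta_P (1\<^sup>2) \<boxplus> beta_P (s\<^sup>2))"
      by (rule Q[OF fd], rule realizes_sum, assumption, rule realizes_Hyps, assumption,
          rule realizes_sum, assumption, rule realizes_Singles, assumption,
          rule realizes_sum, assumption, rule realizes_Single, simp only: dec_single,
          rule realizes_Single, simp only: dec_single)
    \<comment> \<open>n = 2 means \<open>l = 0\<close>, where \<open>s \<noteq> 1\<close>; squaring
      is injective.\<close>
    moreover have "1 + s\<^sup>2 \<noteq> 0" if "n = 2"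
      using that n s square_eq[of 1 s] by auto
    ultimately show ?thesis using n m by (intro exI[of _ "s\<^sup>2"]) auto
  qed
  show ?thesis
  proof (cases "Unit \<in> set as")
    case True
    then show ?thesis using normal_form_Unit[OF as] A B by metis
  next
    case nU: False
    show ?thesis
    proof (cases "\<exists>a. Single a \<in> set as")
      case True
      then obtain a where "Single a \<in> set as" by blast
      from normal_form_Single[OF as nU this] E F show ?thesis by (metis append_Cons append_Nil)
    next
      case False
      have "set as \<subseteq> insert Hyp (range (\<lambda>(i, j). Double i j))"
      proof
        fix a assume "a \<in> set as"
        with nU False show "a \<in> insert Hyp (range (\<lambda>(i, j). Double i j))" by (cases a) auto
      qed
      from normal_form_Double[OF as this] C D show ?thesis by (metis append_Cons append_Nil)
    qed
  qed
qed

end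

section \<open>Coordinates\<close>

text \<open>
  Column vectors of a given dimension do not form a type, so coordinate vectors of length \<open>N\<close> are
  represented by the polynomials of degree less than \<open>N\<close>.
\<close>

interpretation poly_space: vector_space "Polynomial.smult :: 'k::field \<Rightarrow> 'k poly \<Rightarrow> 'k poly"
  by unfold_locales (auto simp: smult_add_right smult_add_left)

definition poly_below :: "nat \<Rightarrow> 'k::field poly set" where
  "poly_below N = {p. \<forall>i\<ge>N. coeff p i = 0}"

definition coeff_vec :: "nat \<Rightarrow> 'k::field poly \<Rightarrow> 'k vec" where
  "coeff_vec N p = vec N (coeff p)"

definition vec_poly :: "'k::field vec \<Rightarrow> 'k poly" where
  "vec_poly c = (\<Sum>i<dim_vec c. monom (c $ i) i)"

lemma coeff_vec_carrier [simp]: "coeff_vec N p \<in> carrier_vec N"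
  by (simp add: coeff_vec_def)

lemma coeff_vec_add: "coeff_vec N (p + q) = coeff_vec N p + coeff_vec N q"
  by (auto simp: coeff_vec_def)

lemma coeff_vec_smult: "coeff_vec N (Polynomial.smult c p) = c \<cdot>\<^sub>v coeff_vec N p"
  by (auto simp: coeff_vec_def)

lemma coeff_vec_poly: "coeff (vec_poly c) i = (if i < dim_vec c then c $ i else 0)"
  by (simp add: vec_poly_def coeff_sum)

lemma vec_poly_below: "c \<in> carrier_vec N \<Longrightarrow> vec_poly c \<in> poly_below N"
  by (auto simp: poly_below_def coeff_vec_poly)

lemma coeff_vec_vec_poly [simp]: "c \<in> carrier_vec N \<Longrightarrow> coeff_vec N (vec_poly c) = c"
  by (auto simp: coeff_vec_def coeff_vec_poly)

lemma vec_poly_coeff_vec: "p \<in> poly_below N \<Longrightarrow> vec_poly (coeff_vec N p) = p"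
  by (rule poly_eqI) (auto simp: coeff_vec_poly coeff_vec_def poly_below_def)

lemma vec_poly_add: "c \<in> carrier_vec N \<Longrightarrow> d \<in> carrier_vec N \<Longrightarrow> vec_poly (c + d) = vec_poly c + vec_poly d"
  by (rule poly_eqI) (auto simp: coeff_vec_poly)

lemma vec_poly_smult: "vec_poly (a \<cdot>\<^sub>v c) = Polynomial.smult a (vec_poly c)"
  by (rule poly_eqI) (auto simp: coeff_vec_poly)

lemma bij_coeff_vec: "bij_betw (coeff_vec N) (poly_below N) (carrier_vec N)"
  by (rule bij_betw_byWitness[where f' = vec_poly]) (auto simp: vec_poly_coeff_vec vec_poly_below)

lemma poly_below_subset_span: "poly_below N \<subseteq> poly_space.span (monom 1 ` {..<N})"
proof
  fix p :: "'a::field poly" assume "p \<in> poly_below N"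
  then have "p = (\<Sum>i<N. Polynomial.smult (coeff p i) (monom 1 i))"
    using vec_poly_coeff_vec[of p N] by (simp add: vec_poly_def coeff_vec_def smult_monom)
  also have "\<dots> \<in> poly_space.span (monom 1 ` {..<N})"
    by (intro poly_space.span_sum poly_space.span_scale poly_space.span_base) auto
  finally show "p \<in> poly_space.span (monom 1 ` {..<N})" .
qed

lemma independent_monoms: "poly_space.independent (monom (1 :: 'k::field) ` A)"
  unfolding poly_space.dependent_def
proof safe
  fix i assume "monom (1 :: 'k) i \<in> poly_space.span (monom 1 ` A - {monom 1 i})"
  then have "coeff (monom (1 :: 'k) i) i = 0"
    by (induction rule: poly_space.span_induct_alt) (auto split: if_splits)
  then show False by simp
qed

lemma P_blocks_dim:
  "dim_row (diag_block_mat (replicate n P_act)) = 2 * n"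
  "dim_col (diag_block_mat (replicate n P_act)) = 2 * n"
  by (simp_all add: dim_diag_block_mat sum_list_replicate P_act_def mat_of_rows_list_def)

lemma P_blocks_entry:
  assumes "i < 2 * n" "j < 2 * n"
  shows "diag_block_mat (replicate n P_act) $$ (i, j) = (if even j \<and> i = Suc j then 1 else 0 :: 'k::field)"
  using assms
proof (induction n arbitrary: i j)
  case (Suc n)
  have P: "P_act $$ (k, l) = (if k = 1 \<and> l = 0 then 1 else 0 :: 'k)" if "k < 2" "l < 2" for k l
    using that by (auto simp: P_act_def mat_of_rows_list_def less_2_cases_iff)
  have dim: "dim_row P_act = 2" "dim_col P_act = 2" by (simp_all add: P_act_def mat_of_rows_list_def)
  have "diag_block_mat (replicate (Suc n) P_act) $$ (i, j) =
      (if i < 2 then if j < 2 then P_act $$ (i, j) else 0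
       else if j < 2 then 0 else diag_block_mat (replicate n P_act) $$ (i - 2, j - 2) :: 'k)"
    using Suc.prems by (simp add: Let_def P_blocks_dim dim)
  also have "\<dots> = (if even j \<and> i = Suc j then 1 else 0)"
  proof (cases "i < 2 \<or> j < 2")
    case True
    then show ?thesis by (cases "i < 2"; cases "j < 2") (auto simp: P less_2_cases_iff)
  next
    case False
    \<comment> \<open>Removing the first block shifts both indices by 2, which preserves
      parity.\<close>
    then obtain i' j' where ij: "i = i' + 2" "j = j' + 2" by (metis add.commute le_Suc_ex not_less)
    with Suc.prems have "i' < 2 * n" "j' < 2 * n" by auto
    from Suc.IH[OF this] show ?thesis unfolding ij by simp
  qed
  finally show ?case .
qed simp

definition standard_act :: "nat \<Rightarrow> nat \<Rightarrow> 'k::field mat" where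
  "standard_act m n = diag_block_mat (0\<^sub>m m m # replicate n P_act)"

lemma standard_act_carrier: "standard_act m n \<in> carrier_mat (m + 2 * n) (m + 2 * n)"
  by (rule carrier_matI) (simp_all add: standard_act_def Let_def P_blocks_dim)

lemma standard_act_entry:
  assumes "i < m + 2 * n" "j < m + 2 * n"
  shows "standard_act m n $$ (i, j) =
    (if m \<le> j \<and> even (j - m) \<and> i = Suc j then 1 else 0 :: 'k::field)"
proof -
  have "standard_act m n $$ (i, j) = (if i < m then 0 else if j < m then 0
      else diag_block_mat (replicate n P_act) $$ (i - m, j - m) :: 'k)"
    using assms by (simp add: standard_act_def Let_def P_blocks_dim)
  also have "\<dots> = (if m \<le> j \<and> even (j - m) \<and> i = Suc j then 1 else 0)"
  proof (cases "i < m \<or> j < m")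
    case False
    then have "i - m < 2 * n" "j - m < 2 * n" using assms by auto
    then show ?thesis using False by (auto simp: P_blocks_entry)
  qed auto
  finally show ?thesis .
qed

text \<open>Higher coefficients are cut off first, which makes the operator linear and of square
  zero on all polynomials, as the locale demands.\<close>

definition poly_act :: "nat \<Rightarrow> nat \<Rightarrow> 'k::field poly \<Rightarrow> 'k poly" where
  "poly_act m n p = vec_poly (standard_act m n *\<^sub>v coeff_vec (m + 2 * n) p)"

lemma poly_act_monom:
  assumes "j < m + 2 * n"
  shows "poly_act m n (monom 1 j) =
    (if m \<le> j \<and> even (j - m) then monom 1 (Suc j) else 0 :: 'k::field poly)"
proof (rule poly_eqI)
  fix i
  let ?N = "m + 2 * n"
  have dim: "dim_row (standard_act m n) = ?N" "dim_col (standard_act m n) = ?N"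
    using standard_act_carrier[of m n] by auto
  show "coeff (poly_act m n (monom 1 j)) i =
    coeff (if m \<le> j \<and> even (j - m) then monom 1 (Suc j) else 0 :: 'k poly) i"
  proof (cases "i < ?N")
    case True
    have "coeff (poly_act m n (monom 1 j)) i =
        (\<Sum>k<?N. standard_act m n $$ (i, k) * (if k = j then 1 else 0 :: 'k))"
      using True by (auto simp: poly_act_def coeff_vec_poly dim scalar_prod_def coeff_vec_def
          lessThan_atLeast0 intro!: sum.cong)
    also have "\<dots> = standard_act m n $$ (i, j)" using assms by (simp add: if_distrib cong: if_cong)
    finally show ?thesis using assms True by (auto simp: standard_act_entry)
  next
    case False
    \<comment> \<open>A chain starting at an even offset from \<open>m\<close> also ends below
      \<open>?N\<close>, because \<open>2 * n\<close> is even.\<close>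
    have "Suc j < ?N" if "m \<le> j" "even (j - m)"
    proof -
      from that obtain k where "j = m + 2 * k" by (metis evenE le_add_diff_inverse)
      with assms show ?thesis by presburger
    qed
    then show ?thesis using False by (auto simp: poly_act_def coeff_vec_poly dim)
  qed
qed

text \<open>The three parts index the trivial summands, the generators \<open>w\<close> of the
  copies of \<open>P\<close>, and their images \<open>t w\<close>.\<close>

lemma jordan_basis_indices:
  "{..<m} \<union> ((\<lambda>k. m + 2 * k) ` {..<n} \<union> (\<lambda>k. Suc (m + 2 * k)) ` {..<n}) = {..<m + 2 * n}"
    (is "?L = ?R")
proof
  have *: "i \<in> (\<lambda>k. m + 2 * k) ` {..<n} \<union> (\<lambda>k. Suc (m + 2 * k)) ` {..<n}" if "m \<le> i" "i < m + 2 * n" for i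
  proof -
    define k where "k = (i - m) div 2"
    have "k < n" using that by (simp add: k_def)
    moreover have "i = m + 2 * k \<or> i = Suc (m + 2 * k)" using that unfolding k_def by linarith
    ultimately show ?thesis by blast
  qed
  show "?L \<subseteq> ?R" by auto
  show "?R \<subseteq> ?L"
  proof
    fix i assume "i \<in> ?R"
    with * show "i \<in> ?L" by (meson Un_iff lessThan_iff not_less)
  qed
qed

theorem theorem4p13:
  fixes U :: "('k::alg_closed_field, 'v) tmodule"
    and \<beta> :: "'v \<Rightarrow> 'v \<Rightarrow> 'k"
    and m n :: nat
  assumes "CHAR('k) = 2"
    and "ver4_object U"
    and "ver4_isomorphic U (standard_object m n)"
    and "ver4_bilinear_form U \<beta>"
    and "ver4_symmetric U \<beta>"
    and "ver4_nondegenerate U \<beta>"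
  shows
    "(m > 0 \<and> 2 dvd n \<and>
        equivalent_to U \<beta> (alpha1 m \<boxplus> (n div 2) \<boxdot> beta_2P 0)) \<or>
     (m > 0 \<and> n > 0 \<and>
        equivalent_to U \<beta> (alpha1 m \<boxplus> n \<boxdot> beta_P 0)) \<or>
     (2 dvd m \<and> 2 dvd n \<and>
        equivalent_to U \<beta> (alpha2 m \<boxplus> (n div 2) \<boxdot> beta_2P 0)) \<or>
     (2 dvd m \<and> 2 dvd n \<and> n \<ge> 2 \<and>
        equivalent_to U \<beta> (alpha2 m \<boxplus> beta_2P 1 \<boxplus> ((n - 2) div 2) \<boxdot> beta_2P 0)) \<or>
     (\<exists>y. 2 dvd m \<and> n > 0 \<and>
        equivalent_to U \<beta> (alpha2 m \<boxplus> n \<boxdot> beta_P y)) \<or>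
     (\<exists>y. 2 dvd m \<and> n \<ge> 2 \<and> (1 + y, n) \<noteq> (0, 2) \<and>
        equivalent_to U \<beta> (alpha2 m \<boxplus> (n - 2) \<boxdot> beta_P 0 \<boxplus> beta_P 1 \<boxplus> beta_P y))"
  proof -
  let ?N = "m + 2 * n" and ?T = "standard_act m n :: 'k mat"
  have std: "standard_object m n = mat_object ?T"
    by (simp add: standard_object_def standard_act_def)
  have T: "?T \<in> carrier_mat ?N ?N" by (rule standard_act_carrier)
  obtain g where "g \<in> ver4_iso U (mat_object ?T)"
    using assms(3) unfolding ver4_isomorphic_def std by blast
  then have g_bij: "bij_betw g (carrier U) (carrier_vec ?N)"
    and g_add: "\<And>u v. u \<in> carrier U \<Longrightarrow> v \<in> carrier U \<Longrightarrow> g (u \<oplus>\<^bsub>U\<^esub> v) = g u + g v"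
    and g_smult: "\<And>c u. u \<in> carrier U \<Longrightarrow> g (c \<odot>\<^bsub>U\<^esub> u) = c \<cdot>\<^sub>v g u"
    and g_act: "\<And>u. u \<in> carrier U \<Longrightarrow> g (act U u) = ?T *\<^sub>v g u"
    using T by (auto simp: ver4_iso_def ver4_hom_def LinearCombinations.module_hom_def mat_object_def)
  define h where "h = inv_into (carrier U) g"
  have h_bij: "bij_betw h (carrier_vec ?N) (carrier U)"
    unfolding h_def by (rule bij_betw_inv_into[OF g_bij])
  have hg: "h (g u) = u" if "u \<in> carrier U" for u
    unfolding h_def by (rule bij_betw_inv_into_left[OF g_bij that])
  have gh: "g (h c) = c" if "c \<in> carrier_vec ?N" for c
    unfolding h_def by (rule bij_betw_inv_into_right[OF g_bij that])
  have h_in: "h c \<in> carrier U" if "c \<in> carrier_vec ?N" for c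
    using bij_betw_apply[OF h_bij that] .
  interpret VU: vectorspace class_ring U using assms(2) by (simp add: ver4_object_def)
  have act_in: "act U u \<in> carrier U" and act_act: "act U (act U u) = \<zero>\<^bsub>U\<^esub>"
    if "u \<in> carrier U" for u
    using assms(2) that by (auto simp: ver4_object_def LinearCombinations.module_hom_def)
  have h_add: "h (c + d) = h c \<oplus>\<^bsub>U\<^esub> h d" if "c \<in> carrier_vec ?N" "d \<in> carrier_vec ?N" for c d
    using hg[of "h c \<oplus>\<^bsub>U\<^esub> h d"] that by (simp add: g_add h_in gh)
  have h_smult: "h (a \<cdot>\<^sub>v c) = a \<odot>\<^bsub>U\<^esub> h c" if "c \<in> carrier_vec ?N" for a c
    using hg[of "a \<odot>\<^bsub>U\<^esub> h c"] that by (simp add: g_smult h_in gh)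
  have h_act: "h (?T *\<^sub>v c) = act U (h c)" if "c \<in> carrier_vec ?N" for c
    using hg[of "act U (h c)"] that by (simp add: g_act h_in gh act_in)
  have beta_add: "\<beta> (u \<oplus>\<^bsub>U\<^esub> v) w = \<beta> u w + \<beta> v w"
    if "u \<in> carrier U" "v \<in> carrier U" "w \<in> carrier U" for u v w
    using assms(4) that
    by (auto simp: ver4_bilinear_form_def LinearCombinations.module_hom_def ver4_unit_def)
  have beta_smult: "\<beta> (c \<odot>\<^bsub>U\<^esub> u) w = c * \<beta> u w" "\<beta> w (c \<odot>\<^bsub>U\<^esub> u) = c * \<beta> w u"
    if "u \<in> carrier U" "w \<in> carrier U" for c u w
    using assms(4) that
    by (auto simp: ver4_bilinear_form_def LinearCombinations.module_hom_def ver4_unit_def)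
  have zero_eq: "0 \<odot>\<^bsub>U\<^esub> u = \<zero>\<^bsub>U\<^esub>" if "u \<in> carrier U" for u
    using VU.lmult_0[OF that] by simp
  have beta_zero: "\<beta> \<zero>\<^bsub>U\<^esub> w = 0" "\<beta> w \<zero>\<^bsub>U\<^esub> = 0" if "w \<in> carrier U" for w
    using beta_smult[OF that that, of 0] zero_eq[OF that] by auto
  have two: "(2::'k) = 0"
    using of_nat_CHAR[where 'a='k] by (simp add: assms(1))
  have minus: "x = y" if "x + y = 0" for x y :: 'k
  proof -
    have "y + y = 0" using two by (simp add: mult_2[symmetric])
    with that show ?thesis by (metis add_right_cancel)
  qed
  have beta_act: "\<beta> u (act U v) = \<beta> (act U u) v" if "u \<in> carrier U" "v \<in> carrier U" for u v
    using assms(4) that minus[of "\<beta> (act U u) v" "\<beta> u (act U v)"]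
    by (auto simp: ver4_bilinear_form_def)
  have beta_sym: "\<beta> u v = \<beta> v u" if u: "u \<in> carrier U" and v: "v \<in> carrier U" for u v
  proof -
    have "\<beta> (act U v) (act U u) = \<beta> (act U (act U v)) u"
      by (rule beta_act) (use act_in u v in auto)
    also have "\<dots> = 0" using act_act[OF v] beta_zero u by simp
    finally show ?thesis using assms(5) u v unfolding ver4_symmetric_def by (metis add_0_right)
  qed
  \<comment> \<open>Injectivity of the map to the dual, applied to \<open>u\<close> and
    zero.\<close>
  have beta_nd: "u = \<zero>\<^bsub>U\<^esub>" if u: "u \<in> carrier U" and "\<And>v. v \<in> carrier U \<Longrightarrow> \<beta> u v = 0" for u
  proof -
    have "inj_on (\<lambda>u. \<lambda>v\<in>carrier U. \<beta> u v) (carrier U)"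
      using assms(6) by (simp add: ver4_nondegenerate_def ver4_iso_def bij_betw_def)
    moreover have "(\<lambda>v\<in>carrier U. \<beta> u v) = (\<lambda>v\<in>carrier U. \<beta> \<zero>\<^bsub>U\<^esub> v)"
      using that(2) beta_zero by (intro restrict_ext) auto
    ultimately show ?thesis using u by (auto dest: inj_onD)
  qed
  \<comment> \<open>Truncation makes \<open>L\<close> additive on all polynomials; it is bijective
    on \<open>poly_below ?N\<close>.\<close>
  define L where "L = (\<lambda>p. h (coeff_vec ?N p))"
  have L_in: "L p \<in> carrier U" for p by (simp add: L_def h_in)
  have L_bij: "bij_betw L (poly_below ?N) (carrier U)"
    using bij_betw_trans[OF bij_coeff_vec h_bij] by (simp add: L_def o_def)
  have L_add: "L (p + q) = L p \<oplus>\<^bsub>U\<^esub> L q" for p q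
    by (simp add: L_def coeff_vec_add h_add)
  have L_smult: "L (Polynomial.smult c p) = c \<odot>\<^bsub>U\<^esub> L p" for c p
    by (simp add: L_def coeff_vec_smult h_smult)
  have L_act: "L (poly_act m n p) = act U (L p)" for p
    using T by (simp add: L_def poly_act_def h_act)
  have act_add: "poly_act m n (p + q) = poly_act m n p + poly_act m n q" for p q :: "'k poly"
    using T by (simp add: poly_act_def coeff_vec_add mult_add_distrib_mat_vec[of _ ?N ?N] vec_poly_add[of _ ?N])
  have act_smult: "poly_act m n (Polynomial.smult c p) = Polynomial.smult c (poly_act m n p)"
    for c and p :: "'k poly"
    using T by (simp add: poly_act_def coeff_vec_smult mult_mat_vec[of _ ?N ?N] vec_poly_smult)
  have act_below: "poly_act m n p \<in> poly_below ?N" for p :: "'k poly"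
    using T by (auto simp: poly_act_def intro: vec_poly_below)
  have L_0: "L 0 = \<zero>\<^bsub>U\<^esub>" using L_smult[of 0 0] zero_eq[OF L_in] by simp
  have below_0: "0 \<in> poly_below ?N" by (simp add: poly_below_def)
  have L_eq_0: "p = 0" if "p \<in> poly_below ?N" "L p = \<zero>\<^bsub>U\<^esub>" for p
    using L_bij that below_0 L_0 unfolding bij_betw_def by (metis inj_onD)
  \<comment> \<open>The form is pulled back along \<open>L\<close>, so it vanishes on monomials of
    degree at least \<open>?N\<close>; nondegeneracy is asserted on
    \<open>poly_below ?N\<close>.\<close>
  interpret nilpotent_form Polynomial.smult "poly_act m n" "\<lambda>p q. \<beta> (L p) (L q)" "poly_below ?N"
  proof unfold_locales
    show "CHAR('k) = 2" by (rule assms(1))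
    show "poly_act m n (poly_act m n p) = 0" for p :: "'k poly"
      by (rule L_eq_0) (simp_all add: act_below L_act act_act L_in)
    show "poly_space.subspace (poly_below ?N)"
      by (auto simp: poly_space.subspace_def poly_below_def)
    show "p = 0" if "p \<in> poly_below ?N" "\<And>q. q \<in> poly_below ?N \<Longrightarrow> \<beta> (L p) (L q) = 0" for p
    proof (rule L_eq_0[OF that(1)], rule beta_nd[OF L_in])
      fix v assume "v \<in> carrier U"
      then obtain q where "q \<in> poly_below ?N" "v = L q"
        using L_bij unfolding bij_betw_def by blast
      then show "\<beta> (L p) v = 0" using that(2) by simp
    qed
    show "\<exists>S. finite S \<and> S \<subseteq> poly_below ?N \<and> poly_below ?N \<subseteq> poly_space.span S"
      using poly_below_subset_span[of ?N]
      by (intro exI[of _ "monom 1 ` {..<?N}"]) (auto simp: poly_below_def)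
  qed (simp_all add: act_add act_smult L_add L_smult L_act beta_add beta_smult beta_act act_below
      L_in beta_sym[OF L_in L_in])
  \<comment> \<open>The monomials, sorted as a Jordan basis, show that \<open>t\<close> has rank n
    on an object of dimension \<open>m + 2 * n\<close>.\<close>
  let ?ls = "map (monom (1::'k)) [0..<m]"
    and ?ws = "map (\<lambda>k. monom (1::'k) (m + 2 * k)) [0..<n]"
  have act_ws: "map (poly_act m n) ?ws = map (\<lambda>k. monom (1::'k) (Suc (m + 2 * k))) [0..<n]"
    by (auto simp: poly_act_monom)
  have set_basis: "set (?ls @ ?ws @ map (poly_act m n) ?ws) = monom (1::'k) ` {..<?N}"
    unfolding act_ws jordan_basis_indices[of m n, symmetric]
    by (auto simp: image_Un image_image lessThan_atLeast0)
  have inj: "inj_on (monom (1::'k)) A" for A by (auto intro!: inj_onI simp: monom_eq_iff')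
  have card_basis: "card (monom (1::'k) ` {..<?N}) = ?N" using card_image[OF inj] by simp
  have basis_below: "monom (1::'k) ` {..<?N} \<subseteq> poly_below ?N" by (auto simp: poly_below_def)
  have dim_V: "poly_space.dim (poly_below ?N :: 'k poly set) = ?N"
    by (rule poly_space.dim_unique[OF basis_below poly_below_subset_span independent_monoms card_basis])
  have "poly_space.dim (poly_act m n ` poly_below ?N :: 'k poly set) = length ?ws"
  proof (rule dim_image_t)
    show "distinct (?ls @ ?ws @ map (poly_act m n) ?ws)"
      by (rule card_distinct) (simp only: set_basis card_basis, simp)
    show "poly_space.independent (set (?ls @ ?ws @ map (poly_act m n) ?ws))"
      unfolding set_basis by (rule independent_monoms)
    show "poly_below ?N \<subseteq> poly_space.span (set (?ls @ ?ws @ map (poly_act m n) ?ws))"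
      unfolding set_basis by (rule poly_below_subset_span)
    show "set ?ws \<subseteq> poly_below ?N" using basis_below set_basis by auto
    show "\<forall>l\<in>set ?ls. poly_act m n l = 0" by (auto simp: poly_act_monom)
  qed
  then have dim_tV: "poly_space.dim (poly_act m n ` poly_below ?N :: 'k poly set) = n" by simp
  show ?thesis
  proof (rule classification[OF dim_V dim_tV, where Q = "equivalent_to U \<beta>"])
    fix as F assume "full_dec as" "\<And>xs. dec as xs \<Longrightarrow> realizes F xs"
    then show "equivalent_to U \<beta> F"
      by (rule equivalent_to_if_realizes[where L = L]) (auto simp: L_bij L_add L_smult L_act)
  qed
qed

end
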